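(* Let $(W,S)$ be a Coxeter system of rank $3$ (i.e. $|S|=3$), with set of reflections $T$. Then all oriented matroid structures on $T\times\{\pm1\}$ arising from realized root systems of $(W,S)$ are equal; that is, $c_\Phi=c_{\Phi'}$ for any two realized root systems $\Phi,\Phi'$ of $(W,S)$.
   Context: For a subset $\Gamma$ of a real vector space, $\mathrm{cone}(\Gamma)$ is the set of finite nonnegative real linear combinations of elements of $\Gamma\cup\{0\}$. $\Gamma$ is positively independent if there are no $n\ge 1$, pairwise distinct $\gamma_1,\dots,\gamma_n\in\Gamma$ and $c_1,\dots,c_n>0$ with $\sum c_i\gamma_i=0$. A realized root system datum is $D=(V,V^\vee,(-,-),\Pi,\Pi^\vee,\iota)$ where: $V,V^\vee$ are real vector spaces with positively independent subsets $\Pi\subseteq V$, $\Pi^\vee\subseteq V^\vee$; $\iota:\Pi\to\Pi^\vee$, $\alpha\mapsto\alpha^\vee$, is a bijection; $(-,-):V\times V^\vee\to\mathbb{R}$ is bilinear with $(\alpha,\alpha^\vee)=2$ for $\alpha\in\Pi$; and for all $\alpha\ne\beta$ in $\Pi$: $(\alpha,\beta^\vee)\le 0$, $(\alpha,\beta^\vee)=0$ iff $(\beta,\alpha^\vee)=0$, and $(\alpha,\beta^\vee)(\beta,\alpha^\vee)\in\{4\cos^2\frac{\pi}{m}\mid m\in\mathbb{N},m\ge 2\}\cup[4,\infty)$. It is assumed that $\Pi$ spans $V$ and $\Pi^\vee$ spans $V^\vee$. For $\alpha\in\Pi$ let $s_\alpha:V\to V$, $v\mapsto v-(v,\alpha^\vee)\alpha$.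 Then $\widehat S=\{s_\alpha\mid\alpha\in\Pi\}$ and the group $\widehat W$ it generates form a Coxeter system ($\alpha\mapsto s_\alpha$ being injective), in which $s_\alpha s_\beta$ ($\alpha\neq\beta$) has order $m$ if $(\alpha,\beta^\vee)(\beta,\alpha^\vee)=4\cos^2\frac{\pi}{m}$ and infinite order if this product is $\ge4$. A realized root system datum of a Coxeter system $(W,S)$ is such a $D$ together with an isomorphism of Coxeter systems $(W,S)\cong(\widehat W,\widehat S)$ (a group isomorphism restricting to a bijection $S\to\widehat S$), regarded as an identification. The corresponding realized root system is $\Phi=W\Pi$; $\Phi^+=\Phi\cap\mathrm{cone}(\Pi)$ and $\Phi=\Phi^+\,\dot\cup\,(-\Phi^+)$. For $\alpha=w(\beta)$ with $w\in W,\beta\in\Pi$, the reflection $s_\alpha=ws_\beta w^{-1}\in T$ is well defined, where $T=\bigcup_{w\in W}wSw^{-1}$. Define $\mathrm{cone}_\Phi(\Gamma)=\mathrm{cone}(\Gamma)\cap\Phi$ for $\Gamma\subseteq\Phi$ and the surjection $\pi:\Phi\to T\times\{\pm1\}$, $\epsilon\alpha\mapsto(s_\alpha,\epsilon)$ for $\alpha\in\Phi^+$, $\epsilon\in\{\pm1\}$. The (reduced) oriented matroid structure on $T\times\{\pm1\}$ given by $\Phi$ is $(T\times\{\pm1\},-,c_\Phi)$, where $-(t,\epsilon)=(t,-\epsilon)$ and $c_\Phi(A)=\pi(\mathrm{cone}_\Phi(\pi^{-1}(A)))$ for $A\subseteq T\times\{\pm1\}$; here an oriented matroid is a set with a fixed-point-free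 involution and a suitable closure operator. *)

theory Defs
  imports
    "HOL-Analysis.Analysis"
    "HOL-Algebra.Bij"
    "HOL-Algebra.Generated_Groups"
    "HOL-Algebra.Multiplicative_Group"
begin

section \<open>Coxeter systems\<close>

definition word_prod :: "('g, 'm) monoid_scheme \<Rightarrow> 'g list \<Rightarrow> 'g" where
  "word_prod W ws = foldr (mult W) ws \<one>\<^bsub>W\<^esub>"

text \<open>
  The relator of \<^term>\<open>s\<close> and \<^term>\<open>t\<close> is the word \<open>(s t)\<^sup>m\<close> with \<open>m\<close> the order of
  \<open>s t\<close> in \<^term>\<open>W\<close>.  Since \<^const>\<open>group.ord\<close> is \<open>0\<close> for elements of infinite order, such pairs
  contribute the empty (that is, no) relator.  For \<open>s = t\<close> the order is \<open>1\<close> and the relator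
  is \<open>s s\<close>; in particular every generator is its own inverse, so words without
  inverse letters suffice.
\<close>

definition coxeter_relator :: "('g, 'm) monoid_scheme \<Rightarrow> 'g \<Rightarrow> 'g \<Rightarrow> 'g list" where
  "coxeter_relator W s t = concat (replicate (group.ord W (s \<otimes>\<^bsub>W\<^esub> t)) [s, t])"

inductive coxeter_equiv :: "('g, 'm) monoid_scheme \<Rightarrow> 'g set \<Rightarrow> 'g list \<Rightarrow> 'g list \<Rightarrow> bool"
  for W :: "('g, 'm) monoid_scheme" and S :: "'g set" where
  refl: "coxeter_equiv W S xs xs"
| sym: "coxeter_equiv W S xs ys \<Longrightarrow> coxeter_equiv W S ys xs"
| trans: "coxeter_equiv W S xs ys \<Longrightarrow> coxeter_equiv W S ys zs \<Longrightarrow> coxeter_equiv W S xs zs"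
| relator: "s \<in> S \<Longrightarrow> t \<in> S \<Longrightarrow> coxeter_equiv W S (xs @ coxeter_relator W s t @ ys) (xs @ ys)"

text \<open>
  \<^term>\<open>W\<close> is presented by the generators \<^term>\<open>S\<close>, which have order \<open>2\<close>, subject to the relations
  \<open>(s t)\<^sup>m = 1\<close> with \<open>m = ord (s t)\<close> finite: every relation between the generators is a
  consequence of these.
\<close>

locale coxeter_system = group W for W :: "('g, 'm) monoid_scheme" (structure) +
  fixes S :: "'g set"
  assumes generators_closed: "S \<subseteq> carrier W"
    and generates: "generate W S = carrier W"
    and generator_order: "s \<in> S \<Longrightarrow> ord s = 2"
    and presentation: "ws \<in> lists S \<Longrightarrow> word_prod W ws = \<one> \<Longrightarrow> coxeter_equiv W S ws []"

definition reflections :: "('g, 'm) monoid_scheme \<Rightarrow> 'g set \<Rightarrow> 'g set" where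
  "reflections W S = {w \<otimes>\<^bsub>W\<^esub> s \<otimes>\<^bsub>W\<^esub> inv\<^bsub>W\<^esub> w | w s. w \<in> carrier W \<and> s \<in> S}"


section \<open>Realized root system data\<close>

definition nonneg_cone :: "'v::real_vector set \<Rightarrow> 'v set" where
  "nonneg_cone \<Gamma> =
     {\<Sum>\<gamma>\<in>F. c \<gamma> *\<^sub>R \<gamma> | F c. finite F \<and> F \<subseteq> insert 0 \<Gamma> \<and> (\<forall>\<gamma>\<in>F. 0 \<le> c \<gamma>)}"

definition positively_independent :: "'v::real_vector set \<Rightarrow> bool" where
  "positively_independent \<Gamma> \<longleftrightarrow>
     \<not> (\<exists>F c. finite F \<and> F \<noteq> {} \<and> F \<subseteq> \<Gamma> \<and> (\<forall>\<gamma>\<in>F. 0 < c \<gamma>) \<and> (\<Sum>\<gamma>\<in>F. c \<gamma> *\<^sub>R \<gamma>) = 0)"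

text \<open>
  The spaces \<open>V\<close> and \<open>V\<^sup>\<or>\<close> are the types \<^typ>\<open>'v\<close> and \<^typ>\<open>'c\<close>; only the values of
  \<open>coroot\<close> on the simple roots are relevant.
\<close>

record ('v, 'c) root_datum =
  pairing :: "'v \<Rightarrow> 'c \<Rightarrow> real"
  simple_roots :: "'v set"
  simple_coroots :: "'c set"
  coroot :: "'v \<Rightarrow> 'c"

locale realized_root_datum =
  fixes D :: "('v::real_vector, 'c::real_vector) root_datum"
  assumes bilinear_pairing: "bilinear (pairing D)"
    and positively_independent_roots: "positively_independent (simple_roots D)"
    and positively_independent_coroots: "positively_independent (simple_coroots D)"
    and bij_coroot: "bij_betw (coroot D) (simple_roots D) (simple_coroots D)"
    and span_roots: "span (simple_roots D) = UNIV"
    and span_coroots: "span (simple_coroots D) = UNIV"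
    and pairing_self: "\<alpha> \<in> simple_roots D \<Longrightarrow> pairing D \<alpha> (coroot D \<alpha>) = 2"
    and pairing_nonpos:
      "\<alpha> \<in> simple_roots D \<Longrightarrow> \<beta> \<in> simple_roots D \<Longrightarrow> \<alpha> \<noteq> \<beta> \<Longrightarrow> pairing D \<alpha> (coroot D \<beta>) \<le> 0"
    and pairing_zero_iff:
      "\<alpha> \<in> simple_roots D \<Longrightarrow> \<beta> \<in> simple_roots D \<Longrightarrow> \<alpha> \<noteq> \<beta> \<Longrightarrow>
         pairing D \<alpha> (coroot D \<beta>) = 0 \<longleftrightarrow> pairing D \<beta> (coroot D \<alpha>) = 0"
    and pairing_prod:
      "\<alpha> \<in> simple_roots D \<Longrightarrow> \<beta> \<in> simple_roots D \<Longrightarrow> \<alpha> \<noteq> \<beta> \<Longrightarrow>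
         pairing D \<alpha> (coroot D \<beta>) * pairing D \<beta> (coroot D \<alpha>)
           \<in> {4 * (cos (pi / real m))\<^sup>2 | m. 2 \<le> m} \<union> {4..}"

definition simple_reflection ::
  "('v::real_vector, 'c::real_vector) root_datum \<Rightarrow> 'v \<Rightarrow> 'v \<Rightarrow> 'v" where
  "simple_reflection D \<alpha> = (\<lambda>v. v - pairing D v (coroot D \<alpha>) *\<^sub>R \<alpha>)"

definition simple_reflections ::
  "('v::real_vector, 'c::real_vector) root_datum \<Rightarrow> ('v \<Rightarrow> 'v) set" where
  "simple_reflections D = simple_reflection D ` simple_roots D"

definition reflection_group ::
  "('v::real_vector, 'c::real_vector) root_datum \<Rightarrow> ('v \<Rightarrow> 'v) monoid" where
  "reflection_group D = subgroup_generated (BijGroup UNIV) (simple_reflections D)"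

text \<open>
  A realized root system datum of \<open>(W, S)\<close>: the isomorphism \<^term>\<open>\<phi>\<close> identifies \<open>(W, S)\<close> with
  the reflection group of \<^term>\<open>D\<close> and its simple reflections, so that \<open>w \<in> W\<close> acts on \<open>V\<close>
  as \<^term>\<open>\<phi> w\<close>.
\<close>

locale realized_root_datum_of = coxeter_system W S + realized_root_datum D
  for W :: "('g, 'm) monoid_scheme" (structure) and S :: "'g set"
    and D :: "('v::real_vector, 'c::real_vector) root_datum" +
  fixes \<phi> :: "'g \<Rightarrow> 'v \<Rightarrow> 'v"
  assumes iso_action: "\<phi> \<in> iso W (reflection_group D)"
    and action_generators: "\<phi> ` S = simple_reflections D"


section \<open>Roots and the closure operator\<close>

definition root_system ::
  "('g, 'm) monoid_scheme \<Rightarrow> ('v::real_vector, 'c::real_vector) root_datum \<Rightarrow> ('g \<Rightarrow> 'v \<Rightarrow> 'v)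
     \<Rightarrow> 'v set" where
  "root_system W D \<phi> = {\<phi> w \<beta> | w \<beta>. w \<in> carrier W \<and> \<beta> \<in> simple_roots D}"

definition positive_roots ::
  "('g, 'm) monoid_scheme \<Rightarrow> ('v::real_vector, 'c::real_vector) root_datum \<Rightarrow> ('g \<Rightarrow> 'v \<Rightarrow> 'v)
     \<Rightarrow> 'v set" where
  "positive_roots W D \<phi> = root_system W D \<phi> \<inter> nonneg_cone (simple_roots D)"

text \<open>The reflection \<open>w s\<^sub>\<beta> w\<^sup>-\<^sup>1 \<in> W\<close> of the root \<open>\<alpha> = w \<beta>\<close>, where \<open>s\<^sub>\<beta> \<in> S\<close> via \<^term>\<open>\<phi>\<close>.\<close>

definition root_reflection ::
  "('g, 'm) monoid_scheme \<Rightarrow> 'g set \<Rightarrow> ('v::real_vector, 'c::real_vector) root_datum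
     \<Rightarrow> ('g \<Rightarrow> 'v \<Rightarrow> 'v) \<Rightarrow> 'v \<Rightarrow> 'g" where
  "root_reflection W S D \<phi> \<alpha> =
     (THE t. \<exists>w \<in> carrier W. \<exists>\<beta> \<in> simple_roots D. \<exists>s \<in> S.
        \<alpha> = \<phi> w \<beta> \<and> \<phi> s = simple_reflection D \<beta> \<and> t = w \<otimes>\<^bsub>W\<^esub> s \<otimes>\<^bsub>W\<^esub> inv\<^bsub>W\<^esub> w)"

text \<open>The map \<open>\<pi> : \<Phi> \<rightarrow> T \<times> {\<plusminus>1}\<close>; a root that is not positive is the negative of a positive one.\<close>

definition signed_reflection ::
  "('g, 'm) monoid_scheme \<Rightarrow> 'g set \<Rightarrow> ('v::real_vector, 'c::real_vector) root_datum
     \<Rightarrow> ('g \<Rightarrow> 'v \<Rightarrow> 'v) \<Rightarrow> 'v \<Rightarrow> 'g \<times> int" where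
  "signed_reflection W S D \<phi> \<alpha> =
     (if \<alpha> \<in> positive_roots W D \<phi> then (root_reflection W S D \<phi> \<alpha>, 1)
      else (root_reflection W S D \<phi> (- \<alpha>), - 1))"

definition root_cone ::
  "('g, 'm) monoid_scheme \<Rightarrow> ('v::real_vector, 'c::real_vector) root_datum \<Rightarrow> ('g \<Rightarrow> 'v \<Rightarrow> 'v)
     \<Rightarrow> 'v set \<Rightarrow> 'v set" where
  "root_cone W D \<phi> \<Gamma> = nonneg_cone \<Gamma> \<inter> root_system W D \<phi>"

text \<open>
  The closure operator \<open>c\<^sub>\<Phi>\<close>.  The underlying set \<open>T \<times> {\<plusminus>1}\<close> of the oriented matroid and its
  involution \<open>(t, \<epsilon>) \<mapsto> (t, -\<epsilon>)\<close> do not depend on the root system.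
\<close>

definition root_closure ::
  "('g, 'm) monoid_scheme \<Rightarrow> 'g set \<Rightarrow> ('v::real_vector, 'c::real_vector) root_datum
     \<Rightarrow> ('g \<Rightarrow> 'v \<Rightarrow> 'v) \<Rightarrow> ('g \<times> int) set \<Rightarrow> ('g \<times> int) set" where
  "root_closure W S D \<phi> A =
     signed_reflection W S D \<phi> `
       root_cone W D \<phi> (signed_reflection W S D \<phi> -` A \<inter> root_system W D \<phi>)"

end

theory Submission
  imports Defs
begin

text \<open>
  In rank three the simple roots form a basis, so a root system is determined by its
  \<open>3 \<times> 3\<close> Cartan matrix and \<open>c\<^sub>\<Phi>\<close> by the signs of the determinants of triples of roots.  Two Cartan
  matrices of the same Coxeter group can be joined by a path of such matrices, interpolating
  the entries geometrically.  Along the path a root stays positive or stays negative, and three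
  roots that are coplanar at one parameter are coplanar at all others: the reflections in the
  roots of a plane are generated by two of them, a relation between words in the generators
  which only depends on the signs of roots.  By continuity no determinant changes its sign.
\<close>

section \<open>Reflections of a Cartan matrix\<close>

text \<open>In general no linear map matches the roots of the two systems, and a ray may contain
  infinitely many roots: for three generators with all orders 3 and suitable entries,
  \<open>2 ^ n\<close> times a simple root is a root for every n. So roots are named by words in the
  generators, the two systems are compared only through signs of roots and equalities of words, and
  finiteness arguments count rays or slopes instead of roots. Rank three enters twice. It makes the
  positively independent simple roots linearly independent, and it turns the vanishing of a
  determinant into a statement about a plane, where one slope parameter orders the positive roots.
  Determinants decide the closure because, by Caratheodory, a root in a cone already lies in the
  cone of linearly independent generators. These extend to a basis of roots, and by Cramer's rule
  the coefficients are quotients of determinants of roots. Interpolation is geometric because the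
  product of two opposite entries, which is what the order of a product of two generators restricts,
  then interpolates geometrically as well.\<close>

text \<open>The entry \<open>A i j\<close> stands for \<open>(\<alpha>\<^sub>i, \<alpha>\<^sub>j\<^sup>\<or>)\<close>, and \<open>axis i 1\<close> for \<open>\<alpha>\<^sub>i\<close>.\<close>

definition reflect :: "('i::finite \<Rightarrow> 'i \<Rightarrow> real) \<Rightarrow> 'i \<Rightarrow> real^'i \<Rightarrow> real^'i" where
  "reflect A i v = v - (\<Sum>j\<in>UNIV. v $ j * A j i) *\<^sub>R axis i 1"

text \<open>Acting by words instead of group elements lets one word be evaluated at every matrix of
  a path.\<close>

definition act :: "('i::finite \<Rightarrow> 'i \<Rightarrow> real) \<Rightarrow> 'i list \<Rightarrow> real^'i \<Rightarrow> real^'i" where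
  "act A w = foldr (reflect A) w"

abbreviation root :: "('i::finite \<Rightarrow> 'i \<Rightarrow> real) \<Rightarrow> 'i list \<Rightarrow> 'i \<Rightarrow> real^'i" where
  "root A w i \<equiv> act A w (axis i 1)"

definition nonneg :: "real^'i \<Rightarrow> bool" where
  "nonneg v \<longleftrightarrow> (\<forall>k. 0 \<le> v $ k)"

locale cartan_matrix =
  fixes A :: "'i::finite \<Rightarrow> 'i \<Rightarrow> real"
  assumes diag: "A i i = 2"
    and nonpos: "i \<noteq> j \<Longrightarrow> A i j \<le> 0"
    and zero_iff: "i \<noteq> j \<Longrightarrow> A i j = 0 \<longleftrightarrow> A j i = 0"
    and prod: "i \<noteq> j \<Longrightarrow> A i j * A j i \<in> {4 * (cos (pi / real m))\<^sup>2 | m. 2 \<le> m} \<union> {4..}"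

lemma act_simps [simp]:
  "act A [] v = v" "act A (i # w) v = reflect A i (act A w v)" "act A (w @ w') v = act A w (act A w' v)"
  by (simp_all add: act_def)

lemma linear_reflect: "linear (reflect A i)"
proof (rule linearI)
  show "reflect A i (r *\<^sub>R b) = r *\<^sub>R reflect A i b" for r b
    by (simp add: reflect_def scaleR_right_diff_distrib sum_distrib_left mult.assoc)
qed (simp add: reflect_def sum.distrib distrib_right scaleR_left_distrib)

lemma linear_act: "linear (act A w)"
proof (induction w)
  case (Cons i w)
  have "act A (i # w) = reflect A i \<circ> act A w" by auto
  then show ?case using Cons linear_reflect linear_compose by metis
qed (simp add: linear_iff)

lemmas act_linear_simps = linear_add[OF linear_act] linear_diff[OF linear_act]
  linear_scale[OF linear_act] linear_neg[OF linear_act] linear_0[OF linear_act]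

lemmas reflect_linear_simps = linear_add[OF linear_reflect] linear_diff[OF linear_reflect]
  linear_scale[OF linear_reflect] linear_neg[OF linear_reflect] linear_0[OF linear_reflect]

lemma reflect_axis: "reflect A i (axis j 1) = axis j 1 - A j i *\<^sub>R axis i 1"
proof -
  have "(\<Sum>k\<in>UNIV. (axis j 1 :: real^'a) $ k * A k i) = (\<Sum>k\<in>UNIV. if k = j then A k i else 0)"
    by (rule sum.cong) (auto simp: axis_def)
  then show ?thesis by (simp add: reflect_def)
qed

lemma reflect_nth: "k \<noteq> i \<Longrightarrow> reflect A i v $ k = v $ k"
  by (simp add: reflect_def axis_def)

lemma nonneg_axis [simp]: "nonneg (axis i 1)"
  by (simp add: nonneg_def axis_def)

lemma axis_one_neq_0 [simp]: "axis i (1::real) \<noteq> 0" "0 \<noteq> axis i (1::real)"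
  using axis_eq_0_iff[of i "1::real"] by auto

lemma nonneg_add: "nonneg u \<Longrightarrow> nonneg v \<Longrightarrow> nonneg (u + v)"
  by (simp add: nonneg_def)

lemma nonneg_scaleR: "0 \<le> c \<Longrightarrow> nonneg v \<Longrightarrow> nonneg (c *\<^sub>R v)"
  by (simp add: nonneg_def)

lemma nonneg_antisym: "nonneg v \<Longrightarrow> nonneg (- v) \<Longrightarrow> v = 0"
  by (simp add: nonneg_def vec_eq_iff) (meson order_antisym)

section \<open>Rank two\<close>

text \<open>Built from the last letter, which acts first. That letter is \<open>t\<close>, so that
  on \<open>axis s 1\<close> the word does not begin with a mere change of sign.\<close>

fun altw :: "nat \<Rightarrow> 'i \<Rightarrow> 'i \<Rightarrow> 'i list" where
  "altw 0 s t = []"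
| "altw (Suc k) s t = altw k t s @ [t]"

lemma length_altw [simp]: "length (altw k s t) = k"
  by (induction k arbitrary: s t) auto

lemma altw_add: "altw (j + k) s t = (if even k then altw j s t else altw j t s) @ altw k s t"
  by (induction k arbitrary: s t) auto

text \<open>The coefficients, up to one factor, of the roots of rank two in terms of the product
  \<open>p\<close> of the two off-diagonal Cartan entries.\<close>

fun dih :: "real \<Rightarrow> nat \<Rightarrow> real \<times> real" where
  "dih p 0 = (1, 0)"
| "dih p (Suc 0) = (1, 1)"
| "dih p (Suc (Suc k)) = (p * snd (dih p (Suc k)) - fst (dih p k), fst (dih p (Suc k)) - snd (dih p k))"

text \<open>The recurrence is the addition formula for sin((x + 2) \<theta>). Only the square of 2
  cos \<theta> occurs in it, so one factor 2 cos \<theta> is divided out of one component, which one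
  depending on the parity.\<close>

lemma dih_cos:
  assumes "sin \<theta> \<noteq> 0" "cos \<theta> \<noteq> 0"
  shows "dih (4 * (cos \<theta>)\<^sup>2) k =
    (if even k then (sin (real (k + 1) * \<theta>) / sin \<theta>, sin (real k * \<theta>) / (2 * cos \<theta> * sin \<theta>))
     else (sin (real k * \<theta>) / sin \<theta>, sin (real (k + 1) * \<theta>) / (2 * cos \<theta> * sin \<theta>)))"
proof (induction "4 * (cos \<theta>)\<^sup>2" k rule: dih.induct)
  case 2
  then show ?case using assms sin_double[of \<theta>] by simp
next
  case (3 k)
  have rec: "sin ((x + 2) * \<theta>) = 2 * cos \<theta> * sin ((x + 1) * \<theta>) - sin (x * \<theta>)" for x :: real
  proof -
    have "sin ((x + 2) * \<theta>) + sin (x * \<theta>) = 2 * sin ((x + 1) * \<theta>) * cos \<theta>"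
      using sin_add[of "(x+1)*\<theta>" \<theta>] sin_diff[of "(x+1)*\<theta>" \<theta>] by (simp add: algebra_simps)
    then show ?thesis by (simp add: mult_ac eq_diff_eq)
  qed
  show ?case
    using 3 assms rec[of "real k"] rec[of "real k + 1"]
    by (auto simp: field_simps power2_eq_square)
qed (use assms in auto)

text \<open>The recurrence subtracts, so nonnegativity alone is not inductive; the induction also
  compares consecutive terms. The factor 2 there is the limit of 2 cos \<theta> at p = 4.\<close>

lemma dih_nonneg_ge_4:
  assumes "4 \<le> p"
  shows "0 \<le> fst (dih p k) \<and> 0 \<le> snd (dih p k)"
proof -
  have "0 \<le> fst (dih p k) \<and> 0 \<le> snd (dih p k) \<and>
    fst (dih p k) \<le> 2 * snd (dih p (Suc k)) \<and> 2 * snd (dih p k) \<le> fst (dih p (Suc k))"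
  proof (induction k)
    case (Suc k)
    have "4 * snd (dih p (Suc k)) \<le> p * snd (dih p (Suc k))"
      using Suc assms by (intro mult_right_mono) auto
    with Suc show ?case by auto
  qed auto
  then show ?thesis by blast
qed

text \<open>For \<open>k < m\<close> all angles in \<open>dih_cos\<close> lie between 0 and \<pi>.
  The case m = 2 is separate because the cosine vanishes there.\<close>

lemma dih_nonneg_cos:
  assumes "2 \<le> m" "k < m"
  shows "0 \<le> fst (dih (4 * (cos (pi / real m))\<^sup>2) k) \<and> 0 \<le> snd (dih (4 * (cos (pi / real m))\<^sup>2) k)"
proof (cases "m = 2")
  case True
  then have "k = 0 \<or> k = Suc 0" using assms by linarith
  then show ?thesis by auto
next
  case False
  define \<theta> where "\<theta> = pi / real m"
  have m: "m \<ge> 3" using False assms by simp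
  have \<theta>: "0 < \<theta>" "\<theta> < pi / 2"
    using m by (auto simp: \<theta>_def field_simps)
  then have c: "cos \<theta> > 0" "sin \<theta> > 0"
    by (auto intro: cos_gt_zero sin_gt_zero2)
  have s: "sin (real j * \<theta>) \<ge> 0" if "j \<le> m" for j
  proof (rule sin_ge_zero)
    show "real j * \<theta> \<le> pi" using that m by (simp add: \<theta>_def field_simps)
  qed (use \<theta> in simp)
  show ?thesis
    using c s[of k] s[of "k+1"] assms dih_cos[of \<theta> k] unfolding \<theta>_def[symmetric] by (auto simp: less_imp_neq)
qed

text \<open>The braid relation on \<open>axis s 1\<close>: after \<open>m\<close> steps the root is
  the negative of the one after \<open>m - 1\<close> steps, since the angle m \<theta> is
  \<pi>.\<close>

lemma dih_braid:
  assumes m: "3 \<le> m"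
  shows "dih (4 * (cos (pi / real m))\<^sup>2) m
    = (- fst (dih (4 * (cos (pi / real m))\<^sup>2) (m - 1)), - snd (dih (4 * (cos (pi / real m))\<^sup>2) (m - 1)))"
proof -
  define \<theta> where "\<theta> = pi / real m"
  have \<theta>: "0 < \<theta>" "\<theta> < pi / 2"
    using m by (auto simp: \<theta>_def field_simps)
  then have c: "cos \<theta> > 0" "sin \<theta> > 0"
    by (auto intro: cos_gt_zero sin_gt_zero2)
  have mt: "real m * \<theta> = pi" using m by (simp add: \<theta>_def)
  have 1: "sin (real (m + 1) * \<theta>) = - sin \<theta>"
    using mt by (simp add: distrib_right)
  have 2: "sin (real (m - 1) * \<theta>) = sin \<theta>"
    using mt m by (simp add: of_nat_diff left_diff_distrib)
  have "m - 1 + 1 = m" "even (m - 1) \<longleftrightarrow> odd m" using m by auto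
  then show ?thesis
    unfolding \<theta>_def[symmetric] using c 1 2 mt dih_cos[of \<theta> m] dih_cos[of \<theta> "m - 1"]
    by (simp add: less_imp_neq)
qed

section \<open>Roots and braid relations of rank two\<close>

context cartan_matrix
begin

lemma reflect_reflect [simp]: "reflect A i (reflect A i v) = v"
proof -
  have "reflect A i v = v - c *\<^sub>R axis i 1" if "c = (\<Sum>j\<in>UNIV. v $ j * A j i)" for c
    using that by (simp add: reflect_def)
  from this[OF HOL.refl] show ?thesis
    by (simp only: reflect_linear_simps reflect_axis diag) (simp add: algebra_simps scaleR_2)
qed

lemma act_rev [simp]: "act A (rev w) (act A w v) = v" "act A w (act A (rev w) v) = v"
  by (induction w arbitrary: v) auto

lemma act_eq_0_iff [simp]: "act A w v = 0 \<longleftrightarrow> v = 0"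
  by (metis act_rev(1) linear_0 linear_act)

text \<open>The last letter produces \<open>axis s 1\<close> and a multiple of
  \<open>axis t 1\<close>. The letter before it negates the former, and on the latter the rest is a
  shorter alternating word with \<open>s\<close> and \<open>t\<close> exchanged. This is the origin
  of the recurrence of \<open>dih\<close>.\<close>

lemma act_altw:
  assumes "s \<noteq> t"
  shows "act A (altw k s t) (axis s 1) = fst (dih (A s t * A t s) k) *\<^sub>R axis s 1
      - (A s t * snd (dih (A s t * A t s) k)) *\<^sub>R axis t 1"
  using assms
proof (induction k arbitrary: s t rule: less_induct)
  case (less k)
  consider "k = 0" | "k = Suc 0" | j where "k = Suc (Suc j)"
    by (metis not0_implies_Suc)
  then show ?case
  proof cases
    case 3
    have "act A (altw k s t) (axis s 1) = - act A (altw j s t) (axis s 1)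
      - A s t *\<^sub>R act A (altw (Suc j) t s) (axis t 1)"
      by (simp add: 3 reflect_axis act_linear_simps reflect_linear_simps diag scaleR_2)
    also have "\<dots> = fst (dih (A s t * A t s) k) *\<^sub>R axis s 1
      - (A s t * snd (dih (A s t * A t s) k)) *\<^sub>R axis t 1"
    proof -
      have 1: "act A (altw (Suc j) t s) (axis t 1) = fst (dih (A s t * A t s) (Suc j)) *\<^sub>R axis t 1
        - (A t s * snd (dih (A s t * A t s) (Suc j))) *\<^sub>R axis s 1"
        using less(1)[of "Suc j" t s] less(2) 3 by (simp add: mult.commute[of "A t s" "A s t"])
      have 2: "act A (altw j s t) (axis s 1) = fst (dih (A s t * A t s) j) *\<^sub>R axis s 1
        - (A s t * snd (dih (A s t * A t s) j)) *\<^sub>R axis t 1"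
        using less(1)[of j s t] less(2) 3 by simp
      show ?thesis
        unfolding 1 2 3 dih.simps fst_conv snd_conv by (simp add: algebra_simps)
    qed
    finally show ?thesis .
  qed (auto simp: reflect_axis)
qed

text \<open>Stands in for the order of the product of the two reflections: an equality of two words
  can be compared between two matrices of the same group.\<close>

definition braid :: "nat \<Rightarrow> 'i \<Rightarrow> 'i \<Rightarrow> bool" where
  "braid k s t \<longleftrightarrow> act A (altw k s t) = act A (altw k t s)"

text \<open>The two words agree on both simple roots and fix every vector on which both coroots
  vanish. These vectors together span, because the determinant 4 - \<open>A s t * A t s\<close> is
  positive.\<close>

lemma braid_cos:
  assumes st: "s \<noteq> t" and m: "2 \<le> m" "A s t * A t s = 4 * (cos (pi / real m))\<^sup>2"
  shows "braid m s t"
proof -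
  obtain n where n: "m = Suc n" using m(1) by (cases m) auto
  have on_s: "act A (altw m s t) (axis s 1) = act A (altw m t s) (axis s 1)"
    if "s \<noteq> t" "A s t * A t s = 4 * (cos (pi / real m))\<^sup>2" for s t
  proof -
    have "act A (altw m t s) (axis s 1) = - act A (altw n s t) (axis s 1)"
      by (simp add: n reflect_axis act_linear_simps reflect_linear_simps diag scaleR_2)
    also have "\<dots> = act A (altw m s t) (axis s 1)"
    proof (cases "m = 2")
      case True
      then have "A s t = 0" using that zero_iff by auto
      then show ?thesis using True n that(1) by (simp add: act_altw reflect_axis numeral_2_eq_2 act_linear_simps reflect_linear_simps diag scaleR_2)
    next
      case False
      then show ?thesis using that dih_braid[of m] m(1) unfolding act_altw[OF that(1)] by (simp add: n del: dih.simps)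
    qed
    finally show ?thesis by simp
  qed
  have on_t: "act A (altw m s t) (axis t 1) = act A (altw m t s) (axis t 1)"
    using on_s[of t s] st m(2) by (simp add: mult.commute)
  have "sin (pi / real m) > 0"
    using m(1) by (intro sin_gt_zero) (auto simp: field_simps)
  then have "(cos (pi / real m))\<^sup>2 < 1"
    by (metis less_add_same_cancel2 sin_cos_squared_add zero_less_power)
  then have det: "4 - A s t * A t s > 0" using m(2) by simp
  show ?thesis
    unfolding braid_def
  proof
    fix v :: "real^'i"
    define cs ct where "cs = (\<Sum>j\<in>UNIV. v $ j * A j s)" and "ct = (\<Sum>j\<in>UNIV. v $ j * A j t)"
    \<comment> \<open>Cramer's rule for the combination of the two simple roots that has the same
      pairings \<open>cs\<close> and \<open>ct\<close> as \<open>v\<close>.\<close>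
    define x y where "x = (2 * cs - A t s * ct) / (4 - A s t * A t s)"
      and "y = (2 * ct - A s t * cs) / (4 - A s t * A t s)"
    define z where "z = v - x *\<^sub>R axis s 1 - y *\<^sub>R axis t 1"
    have "(4 - A s t * A t s) * cs = 2 * (2 * cs - A t s * ct) + (2 * ct - A s t * cs) * A t s"
      "(4 - A s t * A t s) * ct = (2 * cs - A t s * ct) * A s t + 2 * (2 * ct - A s t * cs)"
      by (simp_all add: algebra_simps)
    then have cs: "cs = 2 * x + y * A t s" and ct: "ct = x * A s t + 2 * y"
      using det unfolding x_def y_def by (simp_all add: nonzero_eq_divide_eq flip: add_divide_distrib)
        (simp_all add: mult.commute)
    have v: "v = z + x *\<^sub>R axis s 1 + y *\<^sub>R axis t 1" by (simp add: z_def)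
    have "reflect A s z = z"
      unfolding z_def reflect_linear_simps reflect_axis 
      by (simp add: reflect_def diag flip: cs_def) (simp add: cs algebra_simps)
    moreover have "reflect A t z = z"
      unfolding z_def reflect_linear_simps reflect_axis 
      by (simp add: reflect_def diag flip: ct_def) (simp add: ct algebra_simps)
    ultimately have "act A (altw k s t) z = z \<and> act A (altw k t s) z = z" for k
      by (induction k) auto
    then show "act A (altw m s t) v = act A (altw m t s) v"
      by (simp add: v act_linear_simps on_s[OF st m(2)] on_t)
  qed
qed

text \<open>The absence of braid relations up to length \<open>k\<close> forces \<open>k < m\<close>
  if the order \<open>m\<close> is finite.\<close>

lemma dih_nonneg:
  assumes "s \<noteq> t" "\<And>j. 0 < j \<Longrightarrow> j \<le> k \<Longrightarrow> \<not> braid j s t"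
  shows "0 \<le> fst (dih (A s t * A t s) k) \<and> 0 \<le> snd (dih (A s t * A t s) k)"
proof -
  consider m where "2 \<le> m" "A s t * A t s = 4 * (cos (pi / real m))\<^sup>2" | "4 \<le> A s t * A t s"
    using prod[OF assms(1)] by auto
  then show ?thesis
  proof cases
    case 1
    then have "k < m" using braid_cos[OF assms(1) 1] assms(2)[of m] by force
    then show ?thesis using dih_nonneg_cos 1 by metis
  qed (rule dih_nonneg_ge_4)
qed

text \<open>The word \<open>altw k t s\<close> ends in \<open>s\<close>, which negates
  \<open>axis s 1\<close>. A braid relation would thus equate a positive root with a negative
  one.\<close>

lemma not_braid_if_nonneg:
  assumes st: "s \<noteq> t" and k: "0 < k"
    and nn: "\<And>j. j \<le> k \<Longrightarrow> 0 \<le> fst (dih (A s t * A t s) j) \<and> 0 \<le> snd (dih (A s t * A t s) j)"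
  shows "\<not> braid k s t"
proof
  assume b: "braid k s t"
  obtain n where n: "k = Suc n" using k by (cases k) auto
  have nonneg: "nonneg (act A (altw j s t) (axis s 1))" if "j \<le> k" for j
    using nn[OF that] nonpos[OF st] unfolding act_altw[OF st]
    using st by (auto simp: nonneg_def axis_def mult_nonpos_nonneg)
  have "act A (altw k t s) (axis s 1) = - act A (altw n s t) (axis s 1)"
    by (simp add: n reflect_axis act_linear_simps reflect_linear_simps diag scaleR_2)
  then have "act A (altw k s t) (axis s 1) = - act A (altw n s t) (axis s 1)"
    using b by (simp add: braid_def)
  then show False
    using nonneg[of n] nonneg[of k] nonneg_antisym n by fastforce
qed

lemma not_braid_cos:
  assumes "s \<noteq> t" "2 \<le> m" "A s t * A t s = 4 * (cos (pi / real m))\<^sup>2" "0 < k" "k < m"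
  shows "\<not> braid k s t"
  using assms dih_nonneg_cos[of m] by (intro not_braid_if_nonneg) (auto dest: le_less_trans)

lemma not_braid_ge_4:
  assumes "s \<noteq> t" "4 \<le> A s t * A t s" "0 < k"
  shows "\<not> braid k s t"
  using assms dih_nonneg_ge_4 by (intro not_braid_if_nonneg) auto

end

section \<open>Sign coherence of roots\<close>

context cartan_matrix
begin

definition reduced :: "'i list \<Rightarrow> bool" where
  "reduced w \<longleftrightarrow> (\<forall>w'. act A w' = act A w \<longrightarrow> length w \<le> length w')"

lemma reduced_prefix:
  assumes "reduced (u @ v)"
  shows "reduced u"
  unfolding reduced_def
proof (intro allI impI)
  fix u' assume "act A u' = act A u"
  then have "act A (u' @ v) = act A (u @ v)" by (simp add: fun_eq_iff)
  with assms show "length u \<le> length u'" unfolding reduced_def by fastforce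
qed

lemma ex_reduced: "\<exists>u. act A u = act A w \<and> reduced u"
proof -
  obtain u where "act A u = act A w" "\<And>u'. act A u' = act A w \<Longrightarrow> length u \<le> length u'"
    using ex_has_least_nat[of "\<lambda>u. act A u = act A w" w length] by auto
  then show ?thesis unfolding reduced_def by metis
qed

lemma altw_cases:
  assumes "reduced (v @ x)" "set x \<subseteq> {s, t}"
  shows "x = altw (length x) s t \<or> x = altw (length x) t s"
  using assms
proof (induction x rule: rev_induct)
  case (snoc a x)
  then have IH: "x = altw (length x) s t \<or> x = altw (length x) t s"
    using reduced_prefix[of "v @ x" "[a]"] by simp
  show ?case
  proof (cases x rule: rev_cases)
    case (snoc y b)
    have "b \<noteq> a"
    proof
      assume "b = a"
      then have "act A (v @ y) = act A (v @ x @ [a])"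
        by (simp add: snoc fun_eq_iff)
      then show False
        using snoc.prems(1) unfolding reduced_def snoc by fastforce
    qed
    with IH snoc snoc.prems(2) show ?thesis by auto
  qed (use snoc.prems in auto)
qed simp

lemma root_append_altw:
  assumes "s \<noteq> t"
  shows "root A (v @ altw k s t) s = fst (dih (A s t * A t s) k) *\<^sub>R root A v s
      - (A s t * snd (dih (A s t * A t s) k)) *\<^sub>R root A v t"
  by (simp add: act_altw[OF assms] act_linear_simps)

text \<open>
  Among the words \<open>v x\<close> of minimal length for \<open>w\<close> with \<open>x\<close> in the letters \<open>s\<close> and \<open>t\<close>, where \<open>t\<close> is the
  last letter of \<open>w\<close>, take one with \<open>v\<close> shortest.  Induction applies to \<open>v\<close> and both letters,
  and rank two to \<open>x\<close>.
\<close>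

lemma root_nonneg:
  assumes "reduced w" "\<And>w'. act A w' = act A (w @ [s]) \<Longrightarrow> length w \<le> length w'"
  shows "nonneg (root A w s)"
  using assms
proof (induction "length w" arbitrary: w s rule: less_induct)
  case less
  note red = less.prems(1) and up = less.prems(2)
  show ?case
  proof (cases w rule: rev_cases)
    case (snoc w0 t)
    have st: "s \<noteq> t"
    proof
      assume "s = t"
      then have "act A w0 = act A (w @ [s])" by (simp add: snoc fun_eq_iff)
      from up[OF this] show False by (simp add: snoc)
    qed
    define P where "P n \<longleftrightarrow> (\<exists>v x. length v = n \<and> set x \<subseteq> {s, t} \<and>
      act A (v @ x) = act A w \<and> length v + length x = length w)" for n
    have "P (length w0)"
      unfolding P_def by (rule exI[of _ w0], rule exI[of _ "[t]"]) (simp add: snoc)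
    then have "P (LEAST n. P n)" and le: "(LEAST n. P n) \<le> length w0"
      by (auto intro: LeastI Least_le)
    then obtain v x where v: "length v = (LEAST n. P n)" and x: "set x \<subseteq> {s, t}"
      and vx: "act A (v @ x) = act A w" and len: "length v + length x = length w"
      unfolding P_def by auto
    have red_vx: "reduced (v @ x)"
      using red vx len unfolding reduced_def by simp
    have short: "length v < length w" using v le snoc by simp
    \<comment> \<open>Otherwise the letter \<open>r\<close> could be moved from \<open>v\<close> to
      \<open>x\<close>, against the choice of a shortest \<open>v\<close>.\<close>
    have up_v: "length v \<le> length w'" if r: "r \<in> {s, t}" and w': "act A w' = act A (v @ [r])" for r w'
    proof (rule ccontr)
      assume less': "\<not> length v \<le> length w'"
      have "act A (w' @ r # x) = act A w"
        using w' vx by (simp add: fun_eq_iff)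
      moreover from this have "length w \<le> length (w' @ r # x)"
        using red unfolding reduced_def by blast
      ultimately have "P (length w')"
        unfolding P_def using r x len less'
        by (intro exI[of _ w'] exI[of _ "r # x"]) auto
      then show False using Least_le[of P] v less' by force
    qed
    have nn: "nonneg (root A v s)" "nonneg (root A v t)"
      using less.hyps[OF short reduced_prefix[OF red_vx]] up_v by blast+
    \<comment> \<open>Otherwise \<open>v @ y\<close> would be a word for \<open>w @ [s]\<close>
      shorter than \<open>w\<close>.\<close>
    have not_s: False if "act A (y @ [s]) = act A x" "length y < length x" for y
    proof -
      have "act A x u = act A y (reflect A s u)" for u
        using that(1) by (metis act_simps(1,2,3))
      then have "act A (v @ y) = act A (w @ [s])"
        using vx by (simp add: fun_eq_iff flip: vx)
      from up[OF this] that(2) len show False by simp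
    qed
    have k: "length x > 0" using short len by linarith
    have x_eq: "x = altw (length x) s t"
    proof (rule ccontr)
      assume "x \<noteq> altw (length x) s t"
      then have "x = altw (length x) t s" using altw_cases[OF red_vx x] by blast
      moreover obtain n where "length x = Suc n" using k by (cases "length x") auto
      ultimately show False using not_s[of "altw n s t"] by simp
    qed
    \<comment> \<open>A braid relation inside \<open>x\<close> would replace its end by a word
      ending in \<open>s\<close>.\<close>
    have "\<not> braid j s t" if j: "0 < j" "j \<le> length x" for j
    proof
      assume b: "braid j s t"
      obtain n where n: "j = Suc n" using j by (cases j) auto
      define z where "z = (if even j then altw (length x - j) s t else altw (length x - j) t s)"
      have "x = z @ altw j s t"
        using x_eq altw_add[of "length x - j" j s t] j by (simp add: z_def)
      then have "act A x = act A (z @ altw j t s)"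
        using b by (simp add: braid_def fun_eq_iff)
      then have "act A ((z @ altw n s t) @ [s]) = act A x"
        by (simp add: n)
      moreover have "length (z @ altw n s t) < length x"
      proof -
        have "length z = length x - j" by (simp add: z_def)
        then have "length (z @ altw n s t) = length x - j + n" by simp
        then show ?thesis using j n by linarith
      qed
      ultimately show False by (rule not_s)
    qed
    then have "0 \<le> fst (dih (A s t * A t s) (length x)) \<and> 0 \<le> snd (dih (A s t * A t s) (length x))"
      using dih_nonneg[OF st] by blast
    moreover have "root A w s = root A (v @ altw (length x) s t) s"
      using vx x_eq by metis
    ultimately have "nonneg (root A w s)"
      using nn nonpos[OF st] unfolding root_append_altw[OF st] diff_conv_add_uminus
      by (auto simp flip: scaleR_minus_left intro!: nonneg_add nonneg_scaleR mult_nonpos_nonneg)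
    then show ?thesis .
  qed simp
qed

lemma root_snoc_neg: "root A (w @ [i]) i = - root A w i"
  by (simp add: reflect_axis diag act_linear_simps scaleR_2)

text \<open>Either a reduced word for \<open>w\<close> or a shorter one for \<open>w @ [i]\<close>
  meets the length condition of \<open>root_nonneg\<close>, and the two roots are opposite.\<close>

lemma root_coherent: "nonneg (root A w i) \<or> nonneg (- root A w i)"
proof -
  obtain u where u: "act A u = act A w" "reduced u" using ex_reduced by blast
  show ?thesis
  proof (cases "\<forall>w'. act A w' = act A (u @ [i]) \<longrightarrow> length u \<le> length w'")
    case True
    then show ?thesis using root_nonneg[OF u(2)] u(1) by metis
  next
    case False
    then obtain w' where w': "act A w' = act A (u @ [i])" "length w' < length u" by force
    obtain u' where u': "act A u' = act A w'" "reduced u'" using ex_reduced by blast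
    then have lu': "length u' < length u" using w' unfolding reduced_def by (metis le_less_trans)
    have u'u: "act A (u' @ [i]) = act A u"
      using u' w' by (simp add: fun_eq_iff)
    have "nonneg (root A u' i)"
    proof (rule root_nonneg[OF u'(2)])
      show "length u' \<le> length w''" if "act A w'' = act A (u' @ [i])" for w''
        using that u(2) lu' u'u unfolding reduced_def by (metis le_less_trans less_imp_le not_le)
    qed
    moreover have "root A u' i = - root A w i"
      using root_snoc_neg[of u' i] u'u u(1) by (metis minus_minus)
    ultimately show ?thesis by simp
  qed
qed

text \<open>A nonempty reduced word with last letter \<open>s\<close> sends \<open>axis s 1\<close>
  to a negative root.\<close>

lemma act_eq_id:
  assumes "\<And>k. nonneg (root A w k)"
  shows "act A w v = v"
proof -
  obtain u where u: "act A u = act A w" "reduced u" using ex_reduced by blast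
  show ?thesis
  proof (cases u rule: rev_cases)
    case Nil
    then show ?thesis using u by (metis act_simps(1))
  next
    case (snoc y s)
    have "nonneg (root A y s)"
    proof (rule root_nonneg)
      show "reduced y" using reduced_prefix u(2) snoc by blast
      show "length y \<le> length w'" if "act A w' = act A (y @ [s])" for w'
        using that u(2) snoc unfolding reduced_def by fastforce
    qed
    moreover have "root A w s = - root A y s"
      using root_snoc_neg[of y s] snoc u by metis
    ultimately have "root A y s = 0"
      using assms[of s] nonneg_antisym[of "root A y s"] by simp
    then show ?thesis by simp
  qed
qed

lemma act_conj:
  "act A (w @ [i] @ rev w) v = v - (\<Sum>j\<in>UNIV. act A (rev w) v $ j * A j i) *\<^sub>R root A w i"
  by (simp add: reflect_def act_linear_simps)

text \<open>With \<open>g\<close> carrying \<open>axis i 1\<close> to \<open>axis j 1\<close>, let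
  \<open>x\<close> be the conjugate of reflection \<open>i\<close> by \<open>g\<close>, followed by
  reflection \<open>j\<close>. It fixes \<open>axis j 1\<close> and changes every other simple root
  by a multiple of \<open>axis j 1\<close> only. A coordinate 1 survives, so by coherence no simple
  root becomes negative and \<open>act_eq_id\<close> applies.\<close>

lemma same_root_same_reflection:
  assumes "root A w i = root A u j"
  shows "act A (w @ [i] @ rev w) = act A (u @ [j] @ rev u)"
proof -
  define g where "g = rev u @ w"
  have g: "root A g i = axis j 1"
    using assms by (simp add: g_def)
  then have g': "act A (rev g) (axis j 1) = axis i 1" by (metis act_rev(1))
  define x where "x = [j] @ g @ [i] @ rev g"
  have "nonneg (root A x k)" for k
  proof (cases "k = j")
    case True
    then show ?thesis
      using g g' by (simp add: x_def reflect_axis diag act_linear_simps reflect_linear_simps scaleR_2)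
  next
    case False
    have "act A (g @ [i] @ rev g) (axis k 1) = axis k 1 - c *\<^sub>R axis j 1"
      if "c = (\<Sum>l\<in>UNIV. act A (rev g) (axis k 1) $ l * A l i)" for c
      using act_conj[of g i "axis k 1"] g that by simp
    from this[OF HOL.refl] have "root A x k $ k = 1"
      using False unfolding x_def act_simps(2)[of A j] append_Cons append_Nil
      by (simp add: reflect_nth) (simp add: axis_def)
    then have "\<not> nonneg (- root A x k)"
      unfolding nonneg_def by (metis neg_0_le_iff_le not_one_le_zero vector_uminus_component)
    then show ?thesis using root_coherent by blast
  qed
  then have x: "act A x v = v" for v by (rule act_eq_id)
  show ?thesis
  proof
    fix v
    have "act A (rev u) (act A (w @ [i] @ rev w) v) = act A g (act A [i] (act A (rev g) (act A (rev u) v)))"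
      by (simp add: g_def)
    also have "\<dots> = reflect A j (act A (rev u) v)"
      using x[of "act A (rev u) v"] reflect_reflect[of j] unfolding x_def by (metis act_simps(1,2,3) append_Cons append_Nil)
    finally have "act A u (act A (rev u) (act A (w @ [i] @ rev w) v)) = act A u (reflect A j (act A (rev u) v))"
      by simp
    then show "act A (w @ [i] @ rev w) v = act A (u @ [j] @ rev u) v"
      by simp
  qed
qed

end

section \<open>Coplanar roots\<close>

definition roots :: "('i::finite \<Rightarrow> 'i \<Rightarrow> real) \<Rightarrow> (real^'i) set" where
  "roots A = {root A w i | w i. True}"

context cartan_matrix
begin

lemma root_in_roots [simp]: "root A w i \<in> roots A"
  by (auto simp: roots_def)

lemma act_in_roots: "r \<in> roots A \<Longrightarrow> act A w r \<in> roots A"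
  unfolding roots_def by (force intro: exI[of _ "w @ _"])

lemma roots_coherent: "r \<in> roots A \<Longrightarrow> nonneg r \<or> nonneg (- r)"
  using root_coherent by (auto simp: roots_def)

lemma roots_uminus: "r \<in> roots A \<Longrightarrow> - r \<in> roots A"
  using root_snoc_neg by (auto simp: roots_def simp del: act_simps(3)) metis

lemma roots_nonzero: "r \<in> roots A \<Longrightarrow> r \<noteq> 0"
  by (auto simp: roots_def)

text \<open>A reflection changes only the coordinate \<open>i\<close>, so all other coordinates have
  both signs and vanish.\<close>

lemma nonneg_reflect_imp_multiple:
  assumes "nonneg v" "nonneg (- reflect A i v)" "v \<noteq> 0"
  shows "0 < v $ i \<and> v = v $ i *\<^sub>R axis i 1"
proof -
  have "v $ k = 0" if "k \<noteq> i" for k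
    using assms(1,2) reflect_nth[OF that, of A v] unfolding nonneg_def
    by (metis neg_0_le_iff_le order_antisym vector_uminus_component)
  then have v: "v = v $ i *\<^sub>R axis i 1"
    by (simp add: vec_eq_iff axis_def)
  then have "v $ i \<noteq> 0" using assms(3) by (metis scaleR_zero_left)
  then show ?thesis using v assms(1) unfolding nonneg_def by (metis order_le_less)
qed

text \<open>Each letter adds at most one ray of inverted roots, but a ray may contain infinitely
  many roots. Hence only the values of a function \<open>h\<close> constant on rays are
  counted.\<close>

lemma finite_inversions:
  assumes h: "\<And>c v. 0 < c \<Longrightarrow> h (c *\<^sub>R v) = h v"
  shows "finite {h r | r. r \<in> roots A \<and> nonneg r \<and> nonneg (- act A w r)}"
proof (induction w)
  case Nil
  have "{h r | r. r \<in> roots A \<and> nonneg r \<and> nonneg (- act A [] r)} = {}"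
    using nonneg_antisym roots_nonzero by auto
  then show ?case by (metis finite.emptyI)
next
  case (Cons i w)
  have "{h r | r. r \<in> roots A \<and> nonneg r \<and> nonneg (- act A (i # w) r)}
    \<subseteq> insert (h (root A (rev w) i)) {h r | r. r \<in> roots A \<and> nonneg r \<and> nonneg (- act A w r)}"
  proof clarify
    fix r assume r: "r \<in> roots A" "nonneg r" "nonneg (- act A (i # w) r)"
      "h r \<noteq> h (root A (rev w) i)"
    have "nonneg (- act A w r)"
    proof (rule ccontr)
      assume "\<not> nonneg (- act A w r)"
      then have "nonneg (act A w r)" using roots_coherent act_in_roots r(1) by blast
      then obtain c where c: "0 < c" "act A w r = c *\<^sub>R axis i 1"
        using nonneg_reflect_imp_multiple[of "act A w r" i] r roots_nonzero by auto
      then have "r = c *\<^sub>R root A (rev w) i"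
        by (metis act_rev(1) act_linear_simps(3))
      then show False using h c r(4) by metis
    qed
    then show "\<exists>ra. h r = h ra \<and> ra \<in> roots A \<and> nonneg ra \<and> nonneg (- act A w ra)"
      using r by blast
  qed
  then show ?case using Cons finite_subset by blast
qed

end

section \<open>Transfer of coplanarity between two matrices with equal signs of roots\<close>

locale cartan_pair = A: cartan_matrix A + A': cartan_matrix A'
  for A A' :: "'i::finite \<Rightarrow> 'i \<Rightarrow> real" +
  assumes same_sign: "nonneg (root A w i) \<longleftrightarrow> nonneg (root A' w i)"
begin

lemma same_sign_uminus: "nonneg (- root A w i) \<longleftrightarrow> nonneg (- root A' w i)"
  using same_sign[of "w @ [i]" i] A.root_snoc_neg A'.root_snoc_neg by metis

text \<open>Being a positive multiple of \<open>axis j 1\<close> is a condition on signs alone: the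
  root is positive and reflection \<open>j\<close> makes it negative. The word \<open>rev u\<close>
  reduces to this case.\<close>

lemma proportional_transfer:
  assumes "root A w i = c *\<^sub>R root A u j"
  shows "\<exists>c'. root A' w i = c' *\<^sub>R root A' u j"
proof -
  have pos: "\<exists>c'. root A' w i = c' *\<^sub>R root A' u j" if c: "root A w i = c *\<^sub>R root A u j" "c > 0" for w i c
  proof -
    have r: "root A (rev u @ w) i = c *\<^sub>R axis j 1"
      using c by (simp add: act_linear_simps)
    have "nonneg (root A (rev u @ w) i)"
      unfolding r using c by (simp add: nonneg_scaleR)
    moreover have "root A (j # rev u @ w) i = - c *\<^sub>R axis j 1"
      using r by (simp add: reflect_linear_simps reflect_axis A.diag scaleR_2 del: act_simps(3))
    then have "nonneg (- root A (j # rev u @ w) i)"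
      using c by (simp add: nonneg_scaleR)
    ultimately have "nonneg (root A' (rev u @ w) i)" "nonneg (- root A' (j # rev u @ w) i)"
      using same_sign same_sign_uminus by blast+
    then have "\<exists>c'. root A' (rev u @ w) i = c' *\<^sub>R axis j 1"
      using A'.nonneg_reflect_imp_multiple[of "root A' (rev u @ w) i" j] by auto
    then obtain c' where "act A' (rev u) (root A' w i) = c' *\<^sub>R axis j 1" by auto
    then have "root A' w i = c' *\<^sub>R root A' u j"
      by (metis A'.act_rev(2) act_linear_simps(3))
    then show ?thesis ..
  qed
  have "c \<noteq> 0" using assms by auto
  then consider "c > 0" | "- c > 0" by linarith
  then show ?thesis
  proof cases
    case 2
    then obtain c' where "root A' (w @ [i]) i = c' *\<^sub>R root A' u j"
      using pos[of "w @ [i]" i "- c"] assms A.root_snoc_neg[of w i] by auto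
    then have "root A' w i = (- c') *\<^sub>R root A' u j"
      by (metis A'.root_snoc_neg minus_minus scaleR_minus_left)
    then show ?thesis ..
  qed (use pos assms in blast)
qed

text \<open>
  The positive roots in a plane through a simple root \<open>e\<close> are ordered by their slope
  \<open>\<theta>\<close>, with \<open>e\<close> at infinity.  The reflection in any such root \<open>r\<close> inverts all roots above
  \<open>r\<close> or all roots below \<open>r\<close>, of which there are thus finitely many.  Hence there is a root \<open>d\<close>
  of least slope, and alternately reflecting in \<open>e\<close> and \<open>d\<close> moves every root of the plane to
  a multiple of \<open>e\<close> or \<open>d\<close>.
\<close>

lemma coplanar_transfer:
  assumes b: "b \<in> roots A" "nonneg b" "\<And>c. b \<noteq> c *\<^sub>R axis i 1"
  shows "\<exists>d'. \<forall>w l. (\<exists>x y. root A w l = x *\<^sub>R axis i 1 + y *\<^sub>R b) \<longrightarrow>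
    (\<exists>x y. root A' w l = x *\<^sub>R axis i 1 + y *\<^sub>R d')"
proof -
  define e where "e = (axis i 1 :: real^'i)"
  obtain k where k: "k \<noteq> i" "b $ k > 0"
  proof -
    have "\<exists>k. k \<noteq> i \<and> b $ k \<noteq> 0"
    proof (rule ccontr)
      assume "\<nexists>k. k \<noteq> i \<and> b $ k \<noteq> 0"
      then have "b = b $ i *\<^sub>R axis i 1" by (auto simp: vec_eq_iff axis_def)
      with b(3) show False by blast
    qed
    then show ?thesis using that b(2) unfolding nonneg_def by (metis order_le_less)
  qed
  \<comment> \<open>Linear forms on the whole space which on the span of \<open>e\<close> and
    \<open>b\<close> are the coordinates. The index \<open>k\<close> separates \<open>b\<close> from
    \<open>e\<close>.\<close>
  define Y where "Y v = v $ k / b $ k" for v :: "real^'i"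
  define X where "X v = v $ i - Y v * b $ i" for v :: "real^'i"
  define P where "P v \<longleftrightarrow> v = X v *\<^sub>R e + Y v *\<^sub>R b" for v
  define \<theta> where "\<theta> v = X v / Y v" for v
  define J where "J = {r \<in> roots A. nonneg r \<and> P r \<and> Y r > 0}"
  define \<Theta> where "\<Theta> = \<theta> ` J"
  have Y_lin [simp]: "Y (u + v) = Y u + Y v" "Y (u - v) = Y u - Y v" "Y (c *\<^sub>R v) = c * Y v"
    "Y (- v) = - Y v" for u v c
    by (simp_all add: Y_def add_divide_distrib diff_divide_distrib)
  have X_lin [simp]: "X (u + v) = X u + X v" "X (u - v) = X u - X v" "X (c *\<^sub>R v) = c * X v"
    "X (- v) = - X v" for u v c
    by (simp_all add: X_def algebra_simps)
  have XY_e [simp]: "X e = 1" "Y e = 0" and XY_b [simp]: "X b = 0" "Y b = 1"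
    using k by (simp_all add: X_def Y_def e_def axis_def)
  have P_iff: "P v \<longleftrightarrow> (\<exists>x y. v = x *\<^sub>R e + y *\<^sub>R b)" for v
    unfolding P_def by (auto simp del: scaleR_left_distrib) 
  have P_lin: "P (u + v)" "P (u - v)" "P (c *\<^sub>R u)" "P (- u)" if "P u" "P v" for u v c
  proof -
    from that obtain x y x' y' where "u = x *\<^sub>R e + y *\<^sub>R b" "v = x' *\<^sub>R e + y' *\<^sub>R b"
      unfolding P_iff by blast
    then show "P (u + v)" "P (u - v)" "P (c *\<^sub>R u)" "P (- u)"
      unfolding P_def by (simp_all add: algebra_simps)
  qed
  have P_eqI: "u = v" if "P u" "P v" "X u = X v" "Y u = Y v" for u v
    using that unfolding P_def by metis
  have P_e: "P e" and P_b: "P b" by (simp_all add: P_def)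
  have Y_nonneg: "Y r \<ge> 0" if "nonneg r" for r
    using that k by (simp add: Y_def nonneg_def)
  have b_J: "b \<in> J" using b P_b by (simp add: J_def)
  have on_e: "r = X r *\<^sub>R e" if "P r" "Y r = 0" for r
    using that unfolding P_def by simp
  have X_pos: "X r > 0" if "r \<in> roots A" "nonneg r" "P r" "Y r = 0" for r
  proof -
    have "X r = r $ i" using that(4) by (simp add: X_def)
    moreover have "r $ i \<noteq> 0"
      using on_e[OF that(3,4)] A.roots_nonzero[OF that(1)] \<open>X r = r $ i\<close> by auto
    ultimately show ?thesis using that(2) unfolding nonneg_def by (metis order_le_less)
  qed
  have \<theta>_scale: "\<theta> (c *\<^sub>R v) = \<theta> v" if "0 < c" for c v
    using that by (simp add: \<theta>_def)

  have refl_f: "\<exists>f. linear f \<and> f (root A u j) = 2 \<and> (\<forall>v. act A (u @ [j] @ rev u) v = v - f v *\<^sub>R root A u j)" for u j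
  proof (intro exI conjI allI)
    let ?f = "\<lambda>v. (\<Sum>m\<in>UNIV. act A (rev u) v $ m * A m j)"
    show "linear ?f"
      by (rule linearI) (simp_all add: act_linear_simps sum.distrib distrib_right sum_distrib_left mult.assoc)
    show "?f (root A u j) = 2"
    proof -
      have "(\<Sum>m\<in>UNIV. (axis j 1 :: real^'i) $ m * A m j) = (\<Sum>m\<in>UNIV. if m = j then A m j else 0)"
        by (rule sum.cong) (auto simp: axis_def)
      then show ?thesis by (simp add: A.diag)
    qed
    show "act A (u @ [j] @ rev u) v = v - ?f v *\<^sub>R root A u j" for v
      by (rule A.act_conj)
  qed

  have half_finite: "finite {x \<in> \<Theta>. x > \<theta> r} \<or> finite {x \<in> \<Theta>. x < \<theta> r}" if r: "r \<in> J" for r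
  proof -
    obtain u j where u: "r = root A u j" using r by (auto simp: J_def roots_def)
    define \<rho> where "\<rho> = act A (u @ [j] @ rev u)"
    obtain f where f: "linear f" "f r = 2" "\<And>v. \<rho> v = v - f v *\<^sub>R r"
      using refl_f[of u j] unfolding u \<rho>_def by blast
    have \<rho>r: "\<rho> r = - r" using f by (simp add: scaleR_2)
    have lin: "linear \<rho>" unfolding \<rho>_def by (rule linear_act)
    note \<rho>_lin = linear_add[OF lin] linear_scale[OF lin] linear_diff[OF lin]
    have fin: "finite {\<theta> v | v. v \<in> roots A \<and> nonneg v \<and> nonneg (- \<rho> v)}"
      unfolding \<rho>_def using \<theta>_scale by (rule A.finite_inversions)
    have Yr: "Y r > 0" and Pr: "P r" "nonneg r" using r by (auto simp: J_def)
    \<comment> \<open>A root above \<open>r\<close> is a positive combination of \<open>e\<close>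
      and \<open>r\<close>; one below \<open>r\<close> has a negative coefficient at
      \<open>e\<close>. So the sign of \<open>\<rho> e\<close> decides which side is
      inverted.\<close>
    have "nonneg (\<rho> e) \<or> nonneg (- \<rho> e)"
      unfolding \<rho>_def e_def by (rule A.root_coherent)
    then show ?thesis
    proof
      assume neg: "nonneg (- \<rho> e)"
      have "nonneg (- \<rho> v)" if v: "v \<in> J" "\<theta> v > \<theta> r" for v
      proof -
        define y where "y = Y v / Y r"
        define x where "x = X v - y * X r"
        have Yv: "Y v > 0" and Pv: "P v" using v by (auto simp: J_def)
        have "x > 0" "y > 0"
          using v(2) Yr Yv unfolding \<theta>_def x_def y_def by (simp_all add: field_simps)
        have "v = x *\<^sub>R e + y *\<^sub>R r"
          by (rule P_eqI) (use Yr Pr Pv P_e P_lin in \<open>simp_all add: x_def y_def\<close>)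
        then have "- \<rho> v = x *\<^sub>R (- \<rho> e) + y *\<^sub>R r"
          by (simp add: \<rho>_lin \<rho>r)
        then show ?thesis
          using neg Pr \<open>x > 0\<close> \<open>y > 0\<close> by (metis nonneg_add nonneg_scaleR less_imp_le)
      qed
      then have "{x \<in> \<Theta>. x > \<theta> r} \<subseteq> {\<theta> v | v. v \<in> roots A \<and> nonneg v \<and> nonneg (- \<rho> v)}"
        unfolding \<Theta>_def J_def by blast
      then show ?thesis using fin finite_subset by blast
    next
      assume pos: "nonneg (\<rho> e)"
      have "nonneg (- \<rho> v)" if v: "v \<in> J" "\<theta> v < \<theta> r" for v
      proof -
        define y where "y = Y v / Y r"
        define x where "x = y * X r - X v"
        have Yv: "Y v > 0" and Pv: "P v" using v by (auto simp: J_def)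
        have "x > 0" "y > 0"
          using v(2) Yr Yv unfolding \<theta>_def x_def y_def by (simp_all add: field_simps)
        have "v = y *\<^sub>R r - x *\<^sub>R e"
          by (rule P_eqI) (use Yr Pr Pv P_e P_lin in \<open>simp_all add: x_def y_def\<close>)
        then have "- \<rho> v = x *\<^sub>R \<rho> e + y *\<^sub>R r"
          by (simp add: \<rho>_lin \<rho>r)
        then show ?thesis
          using pos Pr \<open>x > 0\<close> \<open>y > 0\<close> by (metis nonneg_add nonneg_scaleR less_imp_le)
      qed
      then have "{x \<in> \<Theta>. x < \<theta> r} \<subseteq> {\<theta> v | v. v \<in> roots A \<and> nonneg v \<and> nonneg (- \<rho> v)}"
        unfolding \<Theta>_def J_def by blast
      then show ?thesis using fin finite_subset by blast
    qed
  qed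

  \<comment> \<open>The reflection in \<open>e\<close> preserves \<open>J\<close> and reverses the
    order of slopes, so it exchanges finiteness above with finiteness below.\<close>
  obtain c where c: "\<And>r. r \<in> J \<Longrightarrow> reflect A i r \<in> J \<and> \<theta> (reflect A i r) = c - \<theta> r"
  proof -
    define cb where "cb = (\<Sum>j\<in>UNIV. b $ j * A j i)"
    have "reflect A i r \<in> J \<and> \<theta> (reflect A i r) = - cb - \<theta> r" if r: "r \<in> J" for r
    proof -
      have Pr: "P r" and Yr: "Y r > 0" and rA: "r \<in> roots A" using r by (auto simp: J_def)
      have "reflect A i b = b - cb *\<^sub>R e" by (simp add: reflect_def cb_def e_def)
      moreover have "reflect A i e = - e" by (simp add: e_def reflect_axis A.diag scaleR_2)
      moreover have "reflect A i r = X r *\<^sub>R reflect A i e + Y r *\<^sub>R reflect A i b"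
        using Pr unfolding P_def by (metis reflect_linear_simps(1,3))
      ultimately have "reflect A i r = X r *\<^sub>R (- e) + Y r *\<^sub>R (b - cb *\<^sub>R e)" by simp
      then have s: "reflect A i r = (- X r - Y r * cb) *\<^sub>R e + Y r *\<^sub>R b"
        by (simp add: algebra_simps)
      then have P: "P (reflect A i r)" and XY: "X (reflect A i r) = - X r - Y r * cb" "Y (reflect A i r) = Y r"
        unfolding P_iff s by auto
      have in_roots: "reflect A i r \<in> roots A"
        using A.act_in_roots[OF rA, of "[i]"] by simp
      have "\<not> nonneg (- reflect A i r)"
        using Y_nonneg[of "- reflect A i r"] XY Yr by auto
      then have "nonneg (reflect A i r)" using A.roots_coherent[OF in_roots] by blast
      moreover have "\<theta> (reflect A i r) = - cb - \<theta> r"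
        using Yr unfolding \<theta>_def XY by (simp add: field_simps)
      ultimately show ?thesis using in_roots P XY Yr unfolding J_def by simp
    qed
    then show ?thesis using that[of "- cb"] by blast
  qed
  have c': "c - x \<in> \<Theta>" if x: "x \<in> \<Theta>" for x
  proof -
    obtain r where "r \<in> J" "x = \<theta> r" using x unfolding \<Theta>_def by blast
    then show ?thesis using c[of r] unfolding \<Theta>_def by (metis image_eqI)
  qed

  \<comment> \<open>If only the slopes above \<open>b\<close> are finite in number, there is a
    largest slope \<open>m\<close>, and its mirror image \<open>c - m\<close> is the least.\<close>
  obtain d where d: "d \<in> J" "\<And>r. r \<in> J \<Longrightarrow> \<theta> d \<le> \<theta> r"
  proof -
    have "\<exists>m\<in>\<Theta>. \<forall>x\<in>\<Theta>. m \<le> x"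
      using half_finite[OF b_J]
    proof
      assume fin: "finite {x \<in> \<Theta>. x < \<theta> b}"
      then have fin': "finite (insert (\<theta> b) {x \<in> \<Theta>. x < \<theta> b})" by simp
      define m where "m = Min (insert (\<theta> b) {x \<in> \<Theta>. x < \<theta> b})"
      have "m \<in> \<Theta>" using Min_in[OF fin'] b_J unfolding m_def \<Theta>_def by auto
      moreover have "m \<le> x" if "x \<in> \<Theta>" for x
      proof (cases "x < \<theta> b")
        case True
        then show ?thesis using that fin' unfolding m_def by (intro Min_le) auto
      next
        case False
        have "m \<le> \<theta> b" using fin' unfolding m_def by (intro Min_le) auto
        with False show ?thesis by linarith
      qed
      ultimately show ?thesis by blast
    next
      assume fin: "finite {x \<in> \<Theta>. x > \<theta> b}"
      then have fin': "finite (insert (\<theta> b) {x \<in> \<Theta>. x > \<theta> b})" by simp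
      define m where "m = Max (insert (\<theta> b) {x \<in> \<Theta>. x > \<theta> b})"
      have "m \<in> \<Theta>" using Max_in[OF fin'] b_J unfolding m_def \<Theta>_def by auto
      moreover have le: "x \<le> m" if "x \<in> \<Theta>" for x
      proof (cases "x > \<theta> b")
        case True
        then show ?thesis using that fin' unfolding m_def by (intro Max_ge) auto
      next
        case False
        have "m \<ge> \<theta> b" using fin' unfolding m_def by (intro Max_ge) auto
        with False show ?thesis by linarith
      qed
      moreover have "c - m \<le> x" if "x \<in> \<Theta>" for x
        using le[OF c'[OF that]] by linarith
      ultimately show ?thesis using c' by blast
    qed
    then show ?thesis using that unfolding \<Theta>_def by auto
  qed

  obtain u j where u: "d = root A u j" using d by (auto simp: J_def roots_def)
  define wd where "wd = u @ [j] @ rev u"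
  define \<rho> where "\<rho> = act A wd"
  obtain f where f: "linear f" "f d = 2" "\<And>v. \<rho> v = v - f v *\<^sub>R d"
    using refl_f[of u j] unfolding u \<rho>_def wd_def by blast
  note f_lin = linear_add[OF f(1)] linear_scale[OF f(1)] linear_diff[OF f(1)]
  have Yd: "Y d > 0" and Pd: "P d" using d by (auto simp: J_def)
  have \<rho>\<rho>: "\<rho> (\<rho> v) = v" for v by (simp add: f f_lin algebra_simps)
  have \<rho>_roots: "\<rho> v \<in> roots A" if "v \<in> roots A" for v
    using that unfolding \<rho>_def by (rule A.act_in_roots)
  have P_\<rho>: "P (\<rho> v)" if "P v" for v
    using that Pd P_lin unfolding f by blast
  \<comment> \<open>On the plane \<open>\<rho>\<close> has determinant -1, hence it reverses the
    order of slopes among roots that stay positive.\<close>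
  have det\<rho>: "X (\<rho> v) * Y (\<rho> v') - Y (\<rho> v) * X (\<rho> v') = - (X v * Y v' - Y v * X v')"
    if "P v" "P v'" for v v'
  proof -
    have fd: "f v = X v * f e + Y v * f b" if "P v" for v
      using that unfolding P_def by (metis f_lin(1,2) real_scaleR_def)
    have 2: "X d * f e + Y d * f b = 2" using fd[OF Pd] f(2) by simp
    have "X (\<rho> v) * Y (\<rho> v') - Y (\<rho> v) * X (\<rho> v') =
      (X v * Y v' - Y v * X v') * (1 - (X d * f e + Y d * f b))"
      unfolding f fd[OF that(1)] fd[OF that(2)] by (simp add: algebra_simps)
    then show ?thesis unfolding 2 by simp
  qed

  \<comment> \<open>Otherwise \<open>- \<rho> r\<close>, which differs from \<open>- r\<close> by a
    multiple of \<open>d\<close>, is a positive root on the other side of \<open>d\<close>. It would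
    have a slope below the least one or be a negative multiple of \<open>e\<close>.\<close>
  have nonneg_\<rho>: "nonneg (\<rho> r)" if r: "r \<in> J" "\<theta> r > \<theta> d" for r
  proof (rule ccontr)
    assume neg: "\<not> nonneg (\<rho> r)"
    have rr: "r \<in> roots A" "P r" "Y r > 0" using r by (auto simp: J_def)
    define q where "q = - \<rho> r"
    have q: "q \<in> roots A" "nonneg q" "P q"
      unfolding q_def
      using neg A.roots_coherent[OF \<rho>_roots[OF rr(1)]] A.roots_uminus[OF \<rho>_roots[OF rr(1)]]
        P_lin(4)[OF P_\<rho>[OF rr(2)] rr(2)] by simp_all
    have M: "X d * Y q - Y d * X q = X d * Y (- r) - Y d * X (- r)"
      unfolding q_def f by (simp add: algebra_simps)
    moreover have "X r * Y d > X d * Y r"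
      using r(2) rr Yd unfolding \<theta>_def by (simp add: field_simps)
    ultimately have M': "X d * Y q > Y d * X q" by (simp add: algebra_simps)
    have "Y q \<ge> 0" using Y_nonneg q by blast
    then consider "Y q = 0" | "Y q > 0" by linarith
    then show False
    proof cases
      case 1
      then show False using M' mult_pos_pos[OF Yd X_pos[OF q 1]] by simp
    next
      case 2
      then have "q \<in> J" using q by (simp add: J_def)
      then have "\<theta> d \<le> \<theta> q" using d(2) by blast
      then show False using M' 2 Yd unfolding \<theta>_def by (simp add: field_simps)
    qed
  qed

  define d' where "d' = root A' u j"
  \<comment> \<open>The candidate plane for \<open>A'\<close>: \<open>d'\<close> has the same word
    as \<open>d\<close>, so prefixing \<open>i\<close> or \<open>wd\<close> to a word reflects in
    \<open>e\<close> or \<open>d\<close> for \<open>A\<close> and stays within this plane for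
    \<open>A'\<close>.\<close>
  define P' where "P' v \<longleftrightarrow> (\<exists>x y. v = x *\<^sub>R e + y *\<^sub>R d')" for v
  have P'_lin: "P' (u + v)" "P' (u - v)" "P' (c *\<^sub>R u)" if "P' u" "P' v" for u v c
  proof -
    from that obtain x y x' y' where uv: "u = x *\<^sub>R e + y *\<^sub>R d'" "v = x' *\<^sub>R e + y' *\<^sub>R d'"
      unfolding P'_def by blast
    show "P' (u + v)" unfolding P'_def uv
      by (rule exI[of _ "x + x'"], rule exI[of _ "y + y'"]) (simp add: algebra_simps)
    show "P' (u - v)" unfolding P'_def uv
      by (rule exI[of _ "x - x'"], rule exI[of _ "y - y'"]) (simp add: algebra_simps)
    show "P' (c *\<^sub>R u)" unfolding P'_def uv
      by (rule exI[of _ "c * x"], rule exI[of _ "c * y"]) (simp add: algebra_simps)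
  qed
  have P'_e: "P' (c *\<^sub>R e)" and P'_d: "P' (c *\<^sub>R d')" for c
    unfolding P'_def by (rule exI[of _ c], rule exI[of _ 0], simp) (rule exI[of _ 0], rule exI[of _ c], simp)
  have P'_i: "P' (root A' w l)" if "P' (root A' (i # w) l)" for w l
  proof -
    have "root A' w l = reflect A' i (root A' (i # w) l)" by simp
    also have "\<dots> = root A' (i # w) l - z *\<^sub>R e"
      if "z = (\<Sum>m\<in>UNIV. root A' (i # w) l $ m * A' m i)" for z
      using that unfolding e_def reflect_def by simp
    finally have "\<exists>z. root A' w l = root A' (i # w) l - z *\<^sub>R e" by blast
    then show ?thesis using that P'_e P'_lin by metis
  qed
  have P'_wd: "P' (root A' w l)" if "P' (root A' (wd @ w) l)" for w l
  proof -
    have "root A' w l = act A' wd (root A' (wd @ w) l)" by (simp add: wd_def)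
    also have "\<exists>z. \<dots> = root A' (wd @ w) l - z *\<^sub>R d'"
      unfolding d'_def using A'.act_conj[of u j "root A' (wd @ w) l"] unfolding wd_def by blast
    finally show ?thesis using that P'_d P'_lin by metis
  qed
  have P'_on_e: "P' (root A' w l)" if "root A w l = z *\<^sub>R e" for w l z
    using proportional_transfer[of w l z "[]" i] that P'_e unfolding e_def by auto
  have P'_on_d: "P' (root A' w l)" if "root A w l = z *\<^sub>R d" for w l z
    using proportional_transfer[of w l z u j] that P'_d unfolding u d'_def by auto

  \<comment> \<open>Induction on the number of slopes below the root. Reflecting in \<open>d\<close>
    and then in \<open>e\<close> lowers this number, unless a multiple of \<open>d\<close> or
    \<open>e\<close> is met, where \<open>proportional_transfer\<close> applies.\<close>
  have down: "P' (root A' w l)" if "root A w l \<in> J" "finite {x \<in> \<Theta>. x < \<theta> (root A w l)}" for w l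
    using that
  proof (induction "card {x \<in> \<Theta>. x < \<theta> (root A w l)}" arbitrary: w l rule: less_induct)
    case less
    define r where "r = root A w l"
    have r: "r \<in> J" "r \<in> roots A" "P r" "Y r > 0" and fin: "finite {x \<in> \<Theta>. x < \<theta> r}"
      using less.prems by (auto simp: J_def r_def)
    show ?case
    proof (cases "\<theta> r = \<theta> d")
      case True
      have "r = (Y r / Y d) *\<^sub>R d"
        by (rule P_eqI) (use True r Pd Yd P_lin in \<open>simp_all add: \<theta>_def field_simps\<close>)
      then show ?thesis using P'_on_d r_def by blast
    next
      case False
      then have lt: "\<theta> d < \<theta> r" using d(2)[OF r(1)] by linarith
      define r' where "r' = \<rho> r"
      have r': "r' \<in> roots A" "nonneg r'" "P r'"
        unfolding r'_def using nonneg_\<rho>[OF r(1) lt] \<rho>_roots P_\<rho> r by blast+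
      have r'_w: "r' = root A (wd @ w) l" by (simp add: r'_def r_def \<rho>_def)
      show ?thesis
      proof (cases "Y r' = 0")
        case True
        then have "P' (root A' (wd @ w) l)" using P'_on_e on_e[OF r'(3)] r'_w by metis
        then show ?thesis by (rule P'_wd)
      next
        case False
        then have Yr': "Y r' > 0" using Y_nonneg[OF r'(2)] by linarith
        then have r'_J: "r' \<in> J" using r' by (simp add: J_def)
        \<comment> \<open>The Moebius map by which \<open>\<rho>\<close> acts on slopes. Several
          roots may share a slope, so the count needs a map of slopes and not only of roots.\<close>
        define \<tau> where "\<tau> z = (z - (z * f e + f b) * X d) / (1 - (z * f e + f b) * Y d)" for z
        have \<tau>: "\<theta> (\<rho> v) = \<tau> (\<theta> v)" if v: "v \<in> J" for v
        proof -
          have Yv: "Y v > 0" and Pv: "P v" using v by (auto simp: J_def)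
          have fv: "f v = X v * f e + Y v * f b"
            using Pv unfolding P_def by (metis f_lin(1,2) real_scaleR_def)
          have "\<theta> (\<rho> v) = (X v - f v * X d) / (Y v - f v * Y d)" by (simp add: \<theta>_def f)
          also have "\<dots> = ((X v - f v * X d) / Y v) / ((Y v - f v * Y d) / Y v)"
            using Yv by simp
          also have "\<dots> = \<tau> (\<theta> v)"
            using Yv unfolding \<tau>_def \<theta>_def fv
            by (simp add: diff_divide_distrib add_divide_distrib distrib_right)
          finally show ?thesis .
        qed
        \<comment> \<open>Since \<open>\<rho>\<close> reverses the order, a root above
          \<open>r'\<close> is the image of one below \<open>r\<close>. The slope of
          \<open>d\<close> is left out because \<open>\<rho>\<close> makes its roots negative; this
          makes the count drop.\<close>
        have up: "{x \<in> \<Theta>. x > \<theta> r'} \<subseteq> \<tau> ` ({x \<in> \<Theta>. x < \<theta> r} - {\<theta> d})"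
        proof clarify
          fix x assume "x \<in> \<Theta>" "x > \<theta> r'"
          then obtain g where g: "g \<in> J" "x = \<theta> g" "\<theta> g > \<theta> r'" unfolding \<Theta>_def by auto
          have gd: "\<theta> g > \<theta> d" using d(2)[OF r'_J] g by linarith
          have gr: "g \<in> roots A" "P g" "Y g > 0" using g by (auto simp: J_def)
          define h where "h = \<rho> g"
          have h: "h \<in> roots A" "nonneg h" "P h"
            unfolding h_def using nonneg_\<rho>[OF g(1) gd] \<rho>_roots P_\<rho> gr by blast+
          have "X g * Y r' > Y g * X r'"
            using g(3) gr Yr' unfolding \<theta>_def by (simp add: field_simps)
          then have M: "X h * Y r < Y h * X r"
            using det\<rho>[of g r'] gr r' unfolding h_def r'_def \<rho>\<rho> by linarith
          have "Y h \<noteq> 0"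
            using M X_pos[OF h] r by (metis less_asym mult_pos_pos mult_zero_left)
          then have Yh: "Y h > 0" using Y_nonneg[OF h(2)] by linarith
          then have hJ: "h \<in> J" using h by (simp add: J_def)
          have "\<theta> h < \<theta> r" using M Yh r unfolding \<theta>_def by (simp add: field_simps)
          moreover have "\<theta> h \<noteq> \<theta> d"
          proof
            assume eq: "\<theta> h = \<theta> d"
            define z where "z = Y h / Y d"
            have "h = z *\<^sub>R d"
              by (rule P_eqI) (use eq Yh h Pd Yd P_lin in \<open>simp_all add: \<theta>_def z_def field_simps\<close>)
            then have "\<rho> h = z *\<^sub>R d - (z * 2) *\<^sub>R d"
              by (simp only: f(2,3) f_lin(2) real_scaleR_def)
            then have "Y (\<rho> h) = - (z * Y d)" by simp
            moreover have "g = \<rho> h" by (simp add: h_def \<rho>\<rho>)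
            moreover have "z * Y d = Y h" using Yd by (simp add: z_def)
            ultimately have "Y g = - Y h" by simp
            then show False using gr Yh by linarith
          qed
          moreover have "x = \<tau> (\<theta> h)" using \<tau>[OF hJ] g by (simp add: h_def \<rho>\<rho>)
          ultimately show "x \<in> \<tau> ` ({x \<in> \<Theta>. x < \<theta> r} - {\<theta> d})"
            using hJ unfolding \<Theta>_def by blast
        qed
        have fin': "finite ({x \<in> \<Theta>. x < \<theta> r} - {\<theta> d})" using fin by simp
        have "card {x \<in> \<Theta>. x > \<theta> r'} \<le> card ({x \<in> \<Theta>. x < \<theta> r} - {\<theta> d})"
          using up fin' by (meson card_image_le card_mono finite_imageI le_trans)
        also have "\<dots> < card {x \<in> \<Theta>. x < \<theta> r}"
          using fin lt d(1) unfolding \<Theta>_def by (intro card_Diff1_less) auto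
        finally have card_up: "card {x \<in> \<Theta>. x > \<theta> r'} < card {x \<in> \<Theta>. x < \<theta> r}" .
        have fin_up: "finite {x \<in> \<Theta>. x > \<theta> r'}"
          using up fin' by (meson finite_imageI finite_subset)
        have r'': "root A (i # wd @ w) l \<in> J" "\<theta> (root A (i # wd @ w) l) = c - \<theta> r'"
          using c[OF r'_J] unfolding r'_w by simp_all
        have down_up: "{x \<in> \<Theta>. x < c - \<theta> r'} = (\<lambda>x. c - x) ` {x \<in> \<Theta>. x > \<theta> r'}"
        proof (intro subset_antisym subsetI)
          fix x assume "x \<in> {x \<in> \<Theta>. x < c - \<theta> r'}"
          then have "c - x \<in> {x \<in> \<Theta>. x > \<theta> r'}" "x = c - (c - x)" using c' by auto
          then show "x \<in> (\<lambda>x. c - x) ` {x \<in> \<Theta>. x > \<theta> r'}" by blast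
        next
          fix x assume "x \<in> (\<lambda>x. c - x) ` {x \<in> \<Theta>. x > \<theta> r'}"
          then obtain z where "z \<in> \<Theta>" "z > \<theta> r'" "x = c - z" by blast
          then show "x \<in> {x \<in> \<Theta>. x < c - \<theta> r'}" using c'[of z] by simp
        qed
        have "P' (root A' (i # wd @ w) l)"
        proof (rule less.hyps)
          show "card {x \<in> \<Theta>. x < \<theta> (root A (i # wd @ w) l)} < card {x \<in> \<Theta>. x < \<theta> (root A w l)}"
            using card_up card_image_le[OF fin_up, of "\<lambda>x. c - x"]
            unfolding r''(2) down_up r_def by linarith
          show "finite {x \<in> \<Theta>. x < \<theta> (root A (i # wd @ w) l)}"
            unfolding r''(2) down_up using fin_up by simp
        qed (rule r''(1))
        then show ?thesis by (rule P'_wd[OF P'_i])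
      qed
    qed
  qed

  \<comment> \<open>If only the slopes above are finite in number, a reflection in \<open>e\<close>
    first puts them below.\<close>
  have in_J: "P' (root A' w l)" if r: "root A w l \<in> J" for w l
    using half_finite[OF r]
  proof
    assume fin: "finite {x \<in> \<Theta>. x > \<theta> (root A w l)}"
    have r': "root A (i # w) l \<in> J" "\<theta> (root A (i # w) l) = c - \<theta> (root A w l)"
      using c[OF r] by simp_all
    have "{x \<in> \<Theta>. x < c - \<theta> (root A w l)} \<subseteq> (\<lambda>x. c - x) ` {x \<in> \<Theta>. x > \<theta> (root A w l)}"
    proof
      fix x assume "x \<in> {x \<in> \<Theta>. x < c - \<theta> (root A w l)}"
      then have "c - x \<in> {x \<in> \<Theta>. x > \<theta> (root A w l)}" "x = c - (c - x)" using c' by auto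
      then show "x \<in> (\<lambda>x. c - x) ` {x \<in> \<Theta>. x > \<theta> (root A w l)}" by blast
    qed
    then have "P' (root A' (i # w) l)"
      using down[OF r'(1)] fin unfolding r'(2) by (meson finite_imageI finite_subset)
    then show ?thesis by (rule P'_i)
  qed (rule down[OF r])

  have nonneg_case: "P' (root A' w l)" if "P (root A w l)" "nonneg (root A w l)" for w l
  proof (cases "Y (root A w l) = 0")
    case True
    then show ?thesis using P'_on_e on_e that by blast
  next
    case False
    then have "root A w l \<in> J" using Y_nonneg that by (fastforce simp: J_def)
    then show ?thesis by (rule in_J)
  qed
  have "P' (root A' w l)" if "P (root A w l)" for w l
  proof (cases "nonneg (root A w l)")
    case True
    then show ?thesis using nonneg_case that by blast
  next
    case False
    then have "nonneg (root A (w @ [l]) l)" "P (root A (w @ [l]) l)"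
      using A.root_coherent that P_lin unfolding A.root_snoc_neg by blast+
    then have "P' (root A' (w @ [l]) l)" by (rule nonneg_case[rotated])
    then have "P' ((-1) *\<^sub>R root A' (w @ [l]) l)" using P'_lin by blast
    then show ?thesis unfolding A'.root_snoc_neg by simp
  qed
  then show ?thesis unfolding P_iff P'_def e_def by blast
qed

end

section \<open>Deformation of Cartan matrices\<close>

definition det3 :: "real^3 \<Rightarrow> real^3 \<Rightarrow> real^3 \<Rightarrow> real" where
  "det3 a b c = a$1 * (b$2 * c$3 - b$3 * c$2) - a$2 * (b$1 * c$3 - b$3 * c$1)
     + a$3 * (b$1 * c$2 - b$2 * c$1)"

lemma det3_reflect:
  assumes "A i i = 2"
  shows "det3 (reflect A i a) (reflect A i b) (reflect A i c) = - det3 a b c"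
proof -
  have "i = 1 \<or> i = 2 \<or> i = 3" by (rule exhaust_3)
  then show ?thesis
    using assms by (elim disjE) (simp_all add: det3_def reflect_def sum_3 axis_def algebra_simps)
qed

lemma det3_act:
  assumes "\<And>i. A i i = 2"
  shows "det3 (act A w a) (act A w b) (act A w c) = (- 1) ^ length w * det3 a b c"
  by (induction w) (simp_all add: det3_reflect assms)

lemma det3_axis_eq_0:
  assumes "det3 (axis i 1) b c = 0" "\<And>x. b \<noteq> x *\<^sub>R axis i 1"
  shows "\<exists>x y. c = x *\<^sub>R axis i 1 + y *\<^sub>R b"
proof -
  have i: "i = 1 \<or> i = 2 \<or> i = 3" by (rule exhaust_3)
  have "b \<noteq> b $ i *\<^sub>R axis i 1" by (rule assms(2))
  then obtain k where k: "k \<noteq> i" "b $ k \<noteq> 0" by (auto simp: vec_eq_iff axis_def split: if_splits)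
  have "k = 1 \<or> k = 2 \<or> k = 3" by (rule exhaust_3)
  then have "c = (c $ i - c $ k / b $ k * b $ i) *\<^sub>R axis i 1 + (c $ k / b $ k) *\<^sub>R b"
    using i k assms(1)
    by (elim disjE) (auto simp: vec_eq_iff forall_3 det3_def axis_def field_simps)
  then show ?thesis by blast
qed

lemma det3_coplanar:
  "det3 e (x *\<^sub>R e + y *\<^sub>R d) (x' *\<^sub>R e + y' *\<^sub>R d) = 0"
  by (simp add: det3_def algebra_simps)

text \<open>Applying \<open>rev u\<close> changes the determinant only by a sign and makes the first
  root simple. Then the second root is either proportional to it or spans with it a plane to which
  \<open>coplanar_transfer\<close> applies.\<close>

lemma det3_root_eq_0_transfer:
  fixes A A' :: "3 \<Rightarrow> 3 \<Rightarrow> real"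
  assumes "cartan_pair A A'"
    and zero: "det3 (root A u i) (root A v j) (root A w k) = 0"
  shows "det3 (root A' u i) (root A' v j) (root A' w k) = 0"
proof -
  interpret cartan_pair A A' by fact
  define v' where "v' = rev u @ v"
  define w' where "w' = rev u @ w"
  have eq: "det3 (root B u i) (root B v j) (root B w k) = 0 \<longleftrightarrow>
      det3 (axis i 1) (root B v' j) (root B w' k) = 0" if "cartan_matrix B" for B
  proof -
    interpret B: cartan_matrix B by fact
    have "det3 (axis i 1) (root B v' j) (root B w' k) =
        det3 (act B (rev u) (root B u i)) (act B (rev u) (root B v j)) (act B (rev u) (root B w k))"
      by (simp add: v'_def w'_def)
    also have "\<dots> = (- 1) ^ length (rev u) * det3 (root B u i) (root B v j) (root B w k)"
      by (rule det3_act) (rule B.diag)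
    finally show ?thesis by simp
  qed
  have z: "det3 (axis i 1) (root A v' j) (root A w' k) = 0"
    using zero eq[OF A.cartan_matrix_axioms] by simp
  have "det3 (axis i 1) (root A' v' j) (root A' w' k) = 0"
  proof (cases "\<exists>c. root A v' j = c *\<^sub>R axis i 1")
    case True
    then obtain c where "root A' v' j = c *\<^sub>R axis i 1"
      using proportional_transfer[of v' j _ "[]" i] by auto
    then show ?thesis by (simp add: det3_def algebra_simps)
  next
    case False
    define b where "b = (if nonneg (root A v' j) then root A v' j else - root A v' j)"
    have b: "b \<in> roots A" "nonneg b"
      using A.root_coherent A.roots_uminus by (auto simp: b_def)
    have b_nm: "b \<noteq> c *\<^sub>R axis i 1" for c
      using False unfolding b_def by (metis minus_minus scaleR_minus_left)
    obtain d where d: "\<And>w l. \<exists>x y. root A w l = x *\<^sub>R axis i 1 + y *\<^sub>R b \<Longrightarrow>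
        \<exists>x y. root A' w l = x *\<^sub>R axis i 1 + y *\<^sub>R d"
      using coplanar_transfer[OF b b_nm] by blast
    have "root A v' j = 0 *\<^sub>R axis i 1 + 1 *\<^sub>R b \<or> root A v' j = 0 *\<^sub>R axis i 1 + (- 1) *\<^sub>R b"
      by (simp add: b_def)
    then have 1: "\<exists>x y. root A' v' j = x *\<^sub>R axis i 1 + y *\<^sub>R d" by (blast intro: d)
    obtain x y where xy: "root A w' k = x *\<^sub>R axis i 1 + y *\<^sub>R root A v' j"
      using det3_axis_eq_0[OF z] False by blast
    have "root A w' k = x *\<^sub>R axis i 1 + y *\<^sub>R b \<or> root A w' k = x *\<^sub>R axis i 1 + (- y) *\<^sub>R b"
      by (simp add: b_def xy)
    then have 2: "\<exists>x y. root A' w' k = x *\<^sub>R axis i 1 + y *\<^sub>R d" by (blast intro: d)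
    from 1 2 show ?thesis using det3_coplanar by metis
  qed
  then show ?thesis using eq[OF A'.cartan_matrix_axioms] by simp
qed

section \<open>Paths of Cartan matrices\<close>

lemma sgn_constant:
  fixes g :: "real \<Rightarrow> real"
  assumes cont: "continuous_on {0..1} g" and nz: "\<And>t. t \<in> {0..1} \<Longrightarrow> g t \<noteq> 0"
    and st: "s \<in> {0..1}" "t \<in> {0..1}"
  shows "sgn (g s) = sgn (g t)"
proof -
  have conn: "connected (g ` {0..1})"
    using cont by (rule connected_continuous_image) simp
  have "\<not> (g x < 0 \<and> 0 < g y)" if "x \<in> {0..1}" "y \<in> {0..1}" for x y
  proof
    assume "g x < 0 \<and> 0 < g y"
    then have "0 \<in> {g x..g y}" by simp
    then have "0 \<in> g ` {0..1}"
      using connected_contains_Icc[OF conn] that by blast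
    then show False using nz by force
  qed
  then show ?thesis
    using nz st by (metis linorder_less_linear sgn_neg sgn_pos)
qed

lemma continuous_on_act:
  fixes F :: "real \<Rightarrow> 'i::finite \<Rightarrow> 'i \<Rightarrow> real"
  assumes "\<And>i j. continuous_on T (\<lambda>t. F t i j)"
  shows "continuous_on T (\<lambda>t. act (F t) w v)"
proof (induction w)
  case (Cons i w)
  then show ?case
    unfolding act_simps reflect_def by (intro continuous_intros assms)
qed simp

text \<open>By coherence the coordinate sum of a root never vanishes and has the sign of the root.
  It is continuous along the path, so its sign is constant.\<close>

lemma cartan_pair_path:
  fixes F :: "real \<Rightarrow> 'i::finite \<Rightarrow> 'i \<Rightarrow> real"
  assumes cont: "\<And>i j. continuous_on {0..1} (\<lambda>t. F t i j)"
    and cartan: "\<And>t. t \<in> {0..1} \<Longrightarrow> cartan_matrix (F t)"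
    and st: "s \<in> {0..1}" "t \<in> {0..1}"
  shows "cartan_pair (F s) (F t)"
proof -
  have sum_pos: "(\<Sum>k\<in>UNIV. v $ k) > 0" if v: "nonneg v" "v \<noteq> 0" for v :: "real^'i"
  proof -
    obtain k where "v $ k \<noteq> 0" using v(2) by (auto simp: vec_eq_iff)
    then show ?thesis using v(1) unfolding nonneg_def
      by (intro sum_pos2[of _ k]) (auto simp: order_le_less)
  qed
  have "nonneg (root (F s) w i) \<longleftrightarrow> nonneg (root (F t) w i)" for w i
  proof -
    define g where "g t = (\<Sum>k\<in>UNIV. root (F t) w i $ k)" for t
    have "nonneg (root (F t) w i) \<longleftrightarrow> g t > 0" "g t \<noteq> 0" if "t \<in> {0..1}" for t
    proof -
      interpret cartan_matrix "F t" using cartan that .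
      have "nonneg (root (F t) w i) \<Longrightarrow> g t > 0"
        using sum_pos by (simp add: g_def)
      moreover have "nonneg (- root (F t) w i) \<Longrightarrow> - g t > 0"
        using sum_pos[of "- root (F t) w i"] by (simp add: g_def sum_negf)
      ultimately show "nonneg (root (F t) w i) \<longleftrightarrow> g t > 0" "g t \<noteq> 0"
        using root_coherent[of w i] by auto
    qed
    moreover have "continuous_on {0..1} g"
      unfolding g_def by (intro continuous_intros continuous_on_act cont)
    ultimately show ?thesis
      using sgn_constant[of g s t] st by (metis sgn_1_pos)
  qed
  then show ?thesis
    using cartan st by (intro cartan_pair.intro cartan_pair_axioms.intro)
qed

text \<open>The product of opposite entries stays constant if it agrees at both ends, and stays at
  least 4 if it is so at both ends. Linear interpolation of the entries would not keep an admissible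
  value below 4.\<close>

definition cartan_path :: "('i \<Rightarrow> 'i \<Rightarrow> real) \<Rightarrow> ('i \<Rightarrow> 'i \<Rightarrow> real) \<Rightarrow> real \<Rightarrow> 'i \<Rightarrow> 'i \<Rightarrow> real" where
  "cartan_path A A' t i j =
    (if i = j then 2 else if A i j = 0 then 0
     else - ((- A i j) powr (1 - t) * (- A' i j) powr t))"

text \<open>Equality of the orders of products of two reflections:
  \<open>4 * (cos (pi / real m))\<^sup>2\<close> is below 4 and determines m \<ge> 2, while all
  values from 4 on belong to infinite order.\<close>

definition same_type :: "('i \<Rightarrow> 'i \<Rightarrow> real) \<Rightarrow> ('i \<Rightarrow> 'i \<Rightarrow> real) \<Rightarrow> bool" where
  "same_type A A' \<longleftrightarrow> (\<forall>i j. i \<noteq> j \<longrightarrow> A i j * A j i = A' i j * A' j i \<or>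
     (4 \<le> A i j * A j i \<and> 4 \<le> A' i j * A' j i))"

lemma same_type_deformation:
  fixes A A' :: "'i::finite \<Rightarrow> 'i \<Rightarrow> real"
  assumes A: "cartan_matrix A" and A': "cartan_matrix A'" and type: "same_type A A'"
  shows "continuous_on {0..1} (\<lambda>t. cartan_path A A' t i j)"
    and "t \<in> {0..1} \<Longrightarrow> cartan_matrix (cartan_path A A' t)"
    and "cartan_path A A' 0 = A" and "cartan_path A A' 1 = A'"
proof -
  interpret A: cartan_matrix A by fact
  interpret A': cartan_matrix A' by fact
  have zero: "A i j = 0 \<longleftrightarrow> A' i j = 0" if "i \<noteq> j" for i j
    using type that A.zero_iff[OF that] A'.zero_iff[OF that] unfolding same_type_def
    by (metis mult_eq_0_iff not_numeral_le_zero)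
  show "continuous_on {0..1} (\<lambda>t. cartan_path A A' t i j)"
    unfolding cartan_path_def using zero[of i j]
    by (cases "i = j"; cases "A i j = 0") (auto intro!: continuous_intros)
  show "cartan_path A A' 0 = A"
  proof (intro ext)
    show "cartan_path A A' 0 i j = A i j" for i j
      using A.diag A.nonpos[of i j] zero[of i j] by (cases "i = j") (auto simp: cartan_path_def)
  qed
  show "cartan_path A A' 1 = A'"
  proof (intro ext)
    show "cartan_path A A' 1 i j = A' i j" for i j
      using A'.diag A'.nonpos[of i j] zero[of i j] by (cases "i = j") (auto simp: cartan_path_def)
  qed
  assume t: "t \<in> {0..1}"
  show "cartan_matrix (cartan_path A A' t)"
  proof
    fix i j :: 'i assume ij: "i \<noteq> j"
    show "cartan_path A A' t i j * cartan_path A A' t j i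
      \<in> {4 * (cos (pi / real m))\<^sup>2 | m. 2 \<le> m} \<union> {4..}"
    proof (cases "A i j = 0")
      case True
      have "4 * (cos (pi / real 2))\<^sup>2 = 0" by simp
      then have "0 \<in> {4 * (cos (pi / real m))\<^sup>2 | m. 2 \<le> m}" by (metis (mono_tags, lifting) mem_Collect_eq order_refl)
      then show ?thesis using True ij by (simp add: cartan_path_def)
    next
      case False
      then have neg: "A i j < 0" "A j i < 0" "A' i j < 0" "A' j i < 0"
        using A.nonpos[of i j] A.nonpos[of j i] A'.nonpos[of i j] A'.nonpos[of j i]
          A.zero_iff[OF ij] zero[of i j] zero[of j i] ij by (auto simp: order_le_less)
      define p where "p = A i j * A j i"
      define p' where "p' = A' i j * A' j i"
      have pp: "p > 0" "p' > 0" using neg by (auto simp: p_def p'_def mult_neg_neg)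
      have "cartan_path A A' t i j * cartan_path A A' t j i
        = ((- A i j) powr (1 - t) * (- A j i) powr (1 - t)) * ((- A' i j) powr t * (- A' j i) powr t)"
        using ij neg by (simp add: cartan_path_def)
      also have "\<dots> = p powr (1 - t) * p' powr t"
        using neg by (simp add: p_def p'_def flip: powr_mult)
      finally have eq: "cartan_path A A' t i j * cartan_path A A' t j i = p powr (1 - t) * p' powr t" .
      have "p = p' \<or> 4 \<le> p \<and> 4 \<le> p'"
        using type ij unfolding same_type_def p_def p'_def by blast
      then show ?thesis
      proof
        assume "p = p'"
        then have "p powr (1 - t) * p' powr t = p" using pp by (simp flip: powr_add)
        then show ?thesis using A.prod[OF ij] eq p_def by simp
      next
        assume "4 \<le> p \<and> 4 \<le> p'"
        then have "4 powr (1 - t) * 4 powr t \<le> p powr (1 - t) * p' powr t"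
          using t by (intro mult_mono powr_mono2) auto
        moreover have "4 powr (1 - t) * 4 powr t = (4::real)" by (simp flip: powr_add)
        ultimately show ?thesis using eq by simp
      qed
    qed
    show "cartan_path A A' t i j \<le> 0"
      using ij by (simp add: cartan_path_def)
    show "cartan_path A A' t i j = 0 \<longleftrightarrow> cartan_path A A' t j i = 0"
      using ij A.zero_iff[OF ij] zero[of i j] zero[of j i] by (simp add: cartan_path_def)
  qed (simp add: cartan_path_def)
qed

text \<open>Coplanarity transfers between any two parameters of the path, not just its ends, so the
  determinant vanishes everywhere or nowhere.\<close>

lemma same_type_chirotope:
  fixes A A' :: "3 \<Rightarrow> 3 \<Rightarrow> real"
  assumes "cartan_matrix A" "cartan_matrix A'" "same_type A A'"
  shows "sgn (det3 (root A u i) (root A v j) (root A w k))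
    = sgn (det3 (root A' u i) (root A' v j) (root A' w k))"
proof -
  define F where "F = cartan_path A A'"
  note F = same_type_deformation[OF assms, folded F_def]
  define g where "g t = det3 (root (F t) u i) (root (F t) v j) (root (F t) w k)" for t
  have cont: "continuous_on {0..1} g"
    unfolding g_def det3_def by (intro continuous_intros continuous_on_act F)
  have zero: "g t = 0" if "g s = 0" "s \<in> {0..1}" "t \<in> {0..1}" for s t
    using det3_root_eq_0_transfer[OF cartan_pair_path[OF F(1,2)]] that unfolding g_def by blast
  have "sgn (g 0) = sgn (g 1)"
  proof (cases "\<exists>s\<in>{0..1}. g s = 0")
    case True
    then show ?thesis using zero[of _ 0] zero[of _ 1] by auto
  next
    case False
    then show ?thesis using sgn_constant[OF cont] by auto
  qed
  then show ?thesis unfolding g_def F by simp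
qed

lemma same_type_cartan_pair:
  assumes "cartan_matrix A" "cartan_matrix A'" "same_type A A'"
  shows "cartan_pair A A'"
  using cartan_pair_path[of "cartan_path A A'" 0 1] same_type_deformation[OF assms] by simp

text \<open>The order can be read off from words: it is the least positive length of a braid
  relation, and for products from 4 on there is none.\<close>

lemma same_typeI:
  assumes A: "cartan_matrix A" and A': "cartan_matrix A'"
    and braid: "\<And>n i j. i \<noteq> j \<Longrightarrow> cartan_matrix.braid A n i j \<longleftrightarrow> cartan_matrix.braid A' n i j"
  shows "same_type A A'"
  unfolding same_type_def
proof (intro allI impI)
  fix i j :: 'a assume ij: "i \<noteq> j"
  interpret A: cartan_matrix A by fact
  interpret A': cartan_matrix A' by fact
  consider (fin) m m' where "2 \<le> m" "A i j * A j i = 4 * (cos (pi / real m))\<^sup>2"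
      "2 \<le> m'" "A' i j * A' j i = 4 * (cos (pi / real m'))\<^sup>2"
    | (l) m where "2 \<le> m" "A i j * A j i = 4 * (cos (pi / real m))\<^sup>2" "4 \<le> A' i j * A' j i"
    | (r) m where "2 \<le> m" "A' i j * A' j i = 4 * (cos (pi / real m))\<^sup>2" "4 \<le> A i j * A j i"
    | (inf) "4 \<le> A i j * A j i" "4 \<le> A' i j * A' j i"
    using A.prod[OF ij] A'.prod[OF ij] by auto
  then show "A i j * A j i = A' i j * A' j i \<or> 4 \<le> A i j * A j i \<and> 4 \<le> A' i j * A' j i"
  proof cases
    case fin
    have "\<not> m < m'"
      using A.braid_cos[OF ij fin(1,2)] A'.not_braid_cos[OF ij fin(3,4), of m] braid[OF ij] fin by auto
    moreover have "\<not> m' < m"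
      using A'.braid_cos[OF ij fin(3,4)] A.not_braid_cos[OF ij fin(1,2), of m'] braid[OF ij] fin by auto
    ultimately show ?thesis using fin by simp
  next
    case l
    then show ?thesis
      using A.braid_cos[OF ij l(1,2)] A'.not_braid_ge_4[OF ij l(3), of m] braid[OF ij] by auto
  next
    case r
    then show ?thesis
      using A'.braid_cos[OF ij r(1,2)] A.not_braid_ge_4[OF ij r(3), of m] braid[OF ij] by auto
  qed simp
qed

section \<open>Cones\<close>

lemma nonneg_cone_image:
  assumes "linear f" "inj f"
  shows "nonneg_cone (f ` X) = f ` nonneg_cone X"
proof (intro subset_antisym subsetI)
  have f0: "insert 0 (f ` X) = f ` insert 0 X" using assms(1) by (simp add: linear_0)
  have sum: "(\<Sum>\<gamma>\<in>f ` G. c \<gamma> *\<^sub>R \<gamma>) = f (\<Sum>g\<in>G. c (f g) *\<^sub>R g)" for G c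
    using assms by (simp add: sum.reindex inj_on_subset linear_sum linear_scale)
  {
    fix v assume "v \<in> nonneg_cone (f ` X)"
    then obtain F c where F: "v = (\<Sum>\<gamma>\<in>F. c \<gamma> *\<^sub>R \<gamma>)" "finite F" "F \<subseteq> f ` insert 0 X" "\<forall>\<gamma>\<in>F. 0 \<le> c \<gamma>"
      unfolding nonneg_cone_def f0 by blast
    from F(3) obtain G where G: "G \<subseteq> insert 0 X" "F = f ` G" unfolding subset_image_iff by blast
    have "finite G" using F(2) G(2) assms(2) by (metis finite_imageD inj_on_subset subset_UNIV)
    then have "(\<Sum>g\<in>G. c (f g) *\<^sub>R g) \<in> nonneg_cone X"
      using F(4) G unfolding nonneg_cone_def by auto
    then show "v \<in> f ` nonneg_cone X" using F(1) G(2) sum by blast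
  next
    fix v assume "v \<in> f ` nonneg_cone X"
    then obtain G c where G: "v = f (\<Sum>g\<in>G. c g *\<^sub>R g)" "finite G" "G \<subseteq> insert 0 X" "\<forall>g\<in>G. 0 \<le> c g"
      unfolding nonneg_cone_def by blast
    have "v = (\<Sum>\<gamma>\<in>f ` G. (c \<circ> inv_into UNIV f) \<gamma> *\<^sub>R \<gamma>)"
      using assms(2) by (simp add: sum G(1))
    moreover have "\<forall>\<gamma>\<in>f ` G. 0 \<le> (c \<circ> inv_into UNIV f) \<gamma>" using G(4) assms(2) by auto
    moreover have "f ` G \<subseteq> insert 0 (f ` X)" unfolding f0 using G(3) by blast
    ultimately show "v \<in> nonneg_cone (f ` X)"
      unfolding nonneg_cone_def using G(2) by blast
  }
qed

lemma nonneg_cone_axis: "v \<in> nonneg_cone (range (\<lambda>i. axis i 1)) \<longleftrightarrow> nonneg (v :: real^'i)"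
proof
  assume "v \<in> nonneg_cone (range (\<lambda>i. axis i 1))"
  then obtain F c where F: "v = (\<Sum>\<gamma>\<in>F. c \<gamma> *\<^sub>R \<gamma>)" "F \<subseteq> insert 0 (range (\<lambda>i. axis i 1))" "\<forall>\<gamma>\<in>F. 0 \<le> c \<gamma>"
    unfolding nonneg_cone_def by blast
  have "0 \<le> c \<gamma> * \<gamma> $ k" if "\<gamma> \<in> F" for \<gamma> k
    using F(2,3) that by (force simp: axis_def)
  then show "nonneg v" by (simp add: nonneg_def F(1) sum_nonneg)
next
  assume v: "nonneg v"
  have inj: "inj (\<lambda>i. axis i 1 :: real^'i)" by (simp add: inj_def axis_eq_axis)
  define c where "c = (\<lambda>\<gamma>. v $ (inv_into UNIV (\<lambda>i. axis i 1 :: real^'i) \<gamma>))"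
  have "v = (\<Sum>i\<in>UNIV. v $ i *\<^sub>R axis i 1)"
    using basis_expansion[of v] by (simp add: scalar_mult_eq_scaleR)
  also have "\<dots> = (\<Sum>\<gamma>\<in>range (\<lambda>i. axis i 1). c \<gamma> *\<^sub>R \<gamma>)"
    by (simp add: sum.reindex[OF inj] c_def inv_f_f[OF inj])
  finally have "v = (\<Sum>\<gamma>\<in>range (\<lambda>i. axis i 1). c \<gamma> *\<^sub>R \<gamma>)" .
  moreover have "\<forall>\<gamma>\<in>range (\<lambda>i. axis i 1). 0 \<le> c \<gamma>"
    using v by (simp add: nonneg_def c_def)
  ultimately show "v \<in> nonneg_cone (range (\<lambda>i. axis i 1))"
    unfolding nonneg_cone_def by (intro CollectI exI conjI) auto
qed

lemma conic_caratheodory: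
  fixes c :: "'v::real_vector \<Rightarrow> real"
  assumes "finite F" "\<And>x. x \<in> F \<Longrightarrow> 0 \<le> c x"
  shows "\<exists>G d. G \<subseteq> F \<and> independent G \<and> (\<forall>x\<in>G. 0 \<le> d x) \<and> (\<Sum>x\<in>G. d x *\<^sub>R x) = (\<Sum>x\<in>F. c x *\<^sub>R x)"
  using assms
proof (induction "card F" arbitrary: F c rule: less_induct)
  case less
  show ?case
  proof (cases "independent F")
    case True
    then show ?thesis using less.prems by blast
  next
    case False
    then obtain u where u: "\<exists>x\<in>F. u x \<noteq> 0" "(\<Sum>x\<in>F. u x *\<^sub>R x) = 0"
      using dependent_finite[OF less.prems(1)] by auto
    obtain w where w: "\<exists>x\<in>F. w x > (0::real)" "(\<Sum>x\<in>F. w x *\<^sub>R x) = 0"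
    proof (cases "\<exists>x\<in>F. u x > 0")
      case False
      then have "\<exists>x\<in>F. - u x > 0" using u(1) by force
      then show ?thesis using that[of "\<lambda>x. - u x"] u(2) by (simp add: sum_negf)
    qed (use u that in blast)
    define P where "P = {x \<in> F. w x > 0}"
    have P: "finite P" "P \<noteq> {}" using less.prems(1) w by (auto simp: P_def)
    \<comment> \<open>The largest multiple of the dependency \<open>w\<close> whose subtraction
      keeps all coefficients nonnegative; it annihilates the one at \<open>y\<close>.\<close>
    define t where "t = Min ((\<lambda>x. c x / w x) ` P)"
    have "t \<in> (\<lambda>x. c x / w x) ` P" unfolding t_def using P by (intro Min_in) auto
    then obtain y where y: "y \<in> P" "t = c y / w y" by blast
    have t_le: "t \<le> c x / w x" if "x \<in> P" for x
      unfolding t_def using P that by (intro Min_le) auto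
    have t0: "t \<ge> 0" using y less.prems(2) by (auto simp: P_def)
    define d where "d x = c x - t * w x" for x
    have d_nonneg: "0 \<le> d x" if "x \<in> F" for x
    proof (cases "w x > 0")
      case True
      then show ?thesis using t_le[of x] that by (simp add: P_def d_def field_simps)
    next
      case False
      then have "t * w x \<le> 0" using t0 by (simp add: mult_nonneg_nonpos)
      then show ?thesis using less.prems(2)[OF that] by (simp add: d_def)
    qed
    have y_F: "y \<in> F" and dy: "d y = 0" using y by (auto simp: P_def d_def)
    have "(\<Sum>x\<in>F. d x *\<^sub>R x) = (\<Sum>x\<in>F. c x *\<^sub>R x) - t *\<^sub>R (\<Sum>x\<in>F. w x *\<^sub>R x)"
      by (simp add: d_def scaleR_left_diff_distrib sum_subtractf scaleR_sum_right)
    then have eq: "(\<Sum>x\<in>F. c x *\<^sub>R x) = (\<Sum>x\<in>F - {y}. d x *\<^sub>R x)"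
      using w(2) y_F dy less.prems(1) by (simp add: sum.remove)
    have "card (F - {y}) < card F" by (rule card_Diff1_less[OF less.prems(1) y_F])
    from less.hyps[OF this, of d] less.prems(1) d_nonneg
    have "\<exists>G d'. G \<subseteq> F - {y} \<and> independent G \<and> (\<forall>x\<in>G. 0 \<le> d' x)
        \<and> (\<Sum>x\<in>G. d' x *\<^sub>R x) = (\<Sum>x\<in>F - {y}. d x *\<^sub>R x)" by simp
    then show ?thesis unfolding eq by (meson Diff_subset subset_trans)
  qed
qed

section \<open>Determinants and bases\<close>

lemma det3_linear:
  "det3 (x *\<^sub>R a + y *\<^sub>R b + z *\<^sub>R c) v w = x * det3 a v w + y * det3 b v w + z * det3 c v w"
  by (simp add: det3_def algebra_simps)

lemma det3_cycle: "det3 a b c = det3 b c a"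
  by (simp add: det3_def algebra_simps)

text \<open>Otherwise the determinant, being alternating and linear in each argument, vanishes on
  all triples from \<open>{a, b, c}\<close> and so on their span, which contains the unit
  vectors.\<close>

lemma det3_nonzero:
  assumes "span {a, b, c} = (UNIV :: (real^3) set)"
  shows "det3 a b c \<noteq> 0"
proof
  assume z: "det3 a b c = 0"
  have ex: "\<exists>x y z. v = x *\<^sub>R a + y *\<^sub>R b + z *\<^sub>R c" for v
  proof -
    have "v \<in> span {a, b, c}" using assms by simp
    then obtain x where "v - x *\<^sub>R a \<in> span {b, c}" using span_breakdown_eq[of v a] by blast
    then obtain y where "v - x *\<^sub>R a - y *\<^sub>R b \<in> span {c}" using span_breakdown_eq[of _ b] by blast
    then obtain z where "v - x *\<^sub>R a - y *\<^sub>R b = z *\<^sub>R c" by (auto simp: span_singleton)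
    then have "v = x *\<^sub>R a + y *\<^sub>R b + z *\<^sub>R c" by (simp add: diff_eq_eq add_ac)
    then show ?thesis by blast
  qed
  have span1: "det3 v u w = 0" if "det3 a u w = 0" "det3 b u w = 0" "det3 c u w = 0" for u v w
  proof -
    from ex obtain x y z where "v = x *\<^sub>R a + y *\<^sub>R b + z *\<^sub>R c" by blast
    then show ?thesis using that by (simp add: det3_linear)
  qed
  have swap: "det3 u v w = - det3 v u w" "det3 u v w = - det3 u w v" for u v w
    by (simp_all add: det3_def algebra_simps)
  have rep: "det3 u u v = 0" "det3 u v u = 0" for u v by (simp_all add: det3_def algebra_simps)
  have z': "det3 b a c = 0" "det3 c a b = 0"
    using z swap(1)[of b a c] det3_cycle[of c a b] by simp_all
  have pair: "det3 v b c = 0" "det3 v a c = 0" "det3 v a b = 0" for v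
    by (rule span1[OF z rep(1) rep(2)], rule span1[OF rep(1) z'(1) rep(2)],
      rule span1[OF rep(1) rep(2) z'(2)])
  have single: "det3 a w v = 0" "det3 b w v = 0" "det3 c w v = 0" for v w
  proof -
    have "det3 b v a = 0" "det3 c v a = 0" "det3 a v b = 0" "det3 c v b = 0" "det3 a v c = 0" "det3 b v c = 0"
      using pair[of v] unfolding det3_cycle[of b v a] det3_cycle[of c v a] det3_cycle[of a v b]
        det3_cycle[of c v b] det3_cycle[of a v c] det3_cycle[of b v c]
        swap(2)[of v b a] swap(2)[of v c a] swap(2)[of v c b] by simp_all
    note * = this
    show "det3 a w v = 0" "det3 b w v = 0" "det3 c w v = 0"
      unfolding det3_cycle[of a w v] det3_cycle[of b w v] det3_cycle[of c w v]
      by (rule span1[OF rep(2) *(1,2)], rule span1[OF *(3) rep(2) *(4)], rule span1[OF *(5,6) rep(2)])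
  qed
  have "det3 (axis 1 1) (axis 2 1) (axis 3 1) = 0"
    by (rule span1) (rule single)+
  then show False by (simp add: det3_def axis_def)
qed

lemma det3_cramer:
  assumes "det3 a b c \<noteq> 0"
  shows "v = (det3 v b c / det3 a b c) *\<^sub>R a + (det3 a v c / det3 a b c) *\<^sub>R b + (det3 a b v / det3 a b c) *\<^sub>R c"
proof -
  have "det3 a b c *\<^sub>R v = det3 v b c *\<^sub>R a + det3 a v c *\<^sub>R b + det3 a b v *\<^sub>R c"
    by (simp add: vec_eq_iff forall_3 det3_def algebra_simps)
  then have "(1 / det3 a b c) *\<^sub>R (det3 a b c *\<^sub>R v) = (1 / det3 a b c) *\<^sub>R (det3 v b c *\<^sub>R a + det3 a v c *\<^sub>R b + det3 a b v *\<^sub>R c)"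
    by simp
  then show ?thesis using assms by (simp add: scaleR_add_right)
qed

lemma det3_coeff:
  "v = x *\<^sub>R a + y *\<^sub>R b + z *\<^sub>R c \<Longrightarrow> det3 v b c = x * det3 a b c"
  "v = x *\<^sub>R a + y *\<^sub>R b + z *\<^sub>R c \<Longrightarrow> det3 a v c = y * det3 a b c"
  "v = x *\<^sub>R a + y *\<^sub>R b + z *\<^sub>R c \<Longrightarrow> det3 a b v = z * det3 a b c"
  by (simp_all add: det3_def algebra_simps)

text \<open>Cramer's rule expresses \<open>r p\<close> and \<open>r' p\<close> in corresponding
  bases. The coefficients are quotients of determinants with equal signs, so they have equal signs
  too.\<close>

lemma cone_transfer:
  fixes r r' :: "'p \<Rightarrow> real^3"
  assumes chirotope: "\<And>a b c. sgn (det3 (r a) (r b) (r c)) = sgn (det3 (r' a) (r' b) (r' c))"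
    and span: "span (range r) = UNIV"
    and p: "r p \<in> nonneg_cone (r ` K)"
  shows "r' p \<in> nonneg_cone (r' ` K)"
proof -
  obtain F c where F: "finite F" "F \<subseteq> insert 0 (r ` K)" "\<forall>x\<in>F. 0 \<le> c x" "r p = (\<Sum>x\<in>F. c x *\<^sub>R x)"
    using p unfolding nonneg_cone_def by blast
  have "\<exists>G d. G \<subseteq> F \<and> independent G \<and> (\<forall>x\<in>G. 0 \<le> d x) \<and> (\<Sum>x\<in>G. d x *\<^sub>R x) = r p"
    unfolding F(4) by (rule conic_caratheodory) (use F in auto)
  then obtain G d where G: "G \<subseteq> F" "independent G" "\<forall>x\<in>G. 0 \<le> d x" and eq: "(\<Sum>x\<in>G. d x *\<^sub>R x) = r p"
    by (elim exE conjE) (rule that)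
  have "0 \<notin> G" using G(2) dependent_zero by blast
  then have GK: "G \<subseteq> r ` K" using F(2) G(1) by blast
  \<comment> \<open>Cramer's rule needs three vectors. Those added to \<open>G\<close> receive
    coefficient 0.\<close>
  obtain B where B: "G \<subseteq> B" "B \<subseteq> range r" "independent B" "range r \<subseteq> span B"
    using maximal_independent_subset_extend[of G "range r"] G(2) GK by blast
  have spanB: "span B = UNIV" using span_minimal[OF B(4) subspace_span] span by blast
  have "dim (range r) = 3" using dim_span[of "range r"] by (simp add: span)
  then have fB: "finite B" and "card B = 3" using basis_card_eq_dim[OF B(2,4,3)] independent_imp_finite[OF B(3)] by auto
  then obtain b1 b2 b3 where b: "B = {b1, b2, b3}" "b1 \<noteq> b2" "b1 \<noteq> b3" "b2 \<noteq> b3"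
    unfolding card_3_iff by blast
  have nz: "det3 b1 b2 b3 \<noteq> 0" using det3_nonzero spanB b(1) by blast
  \<comment> \<open>An added vector need not have an index in \<open>K\<close>; only members of
    \<open>G\<close> must.\<close>
  have lift: "\<exists>q. r q = x \<and> (x \<in> G \<longrightarrow> q \<in> K)" if "x \<in> B" for x
    using that B(2) GK by (cases "x \<in> G") auto
  obtain q1 where q1: "r q1 = b1" "b1 \<in> G \<longrightarrow> q1 \<in> K" using lift[of b1] b(1) by blast
  obtain q2 where q2: "r q2 = b2" "b2 \<in> G \<longrightarrow> q2 \<in> K" using lift[of b2] b(1) by blast
  obtain q3 where q3: "r q3 = b3" "b3 \<in> G \<longrightarrow> q3 \<in> K" using lift[of b3] b(1) by blast
  note q = q1(1) q2(1) q3(1) and qK = q1(2) q2(2) q3(2)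
  define x where "x g = (if g \<in> G then d g else 0)" for g
  have "r p = (\<Sum>g\<in>B. x g *\<^sub>R g)"
    unfolding eq[symmetric] x_def using fB B(1) by (intro sum.mono_neutral_cong_left) auto
  then have rp: "r p = x b1 *\<^sub>R b1 + x b2 *\<^sub>R b2 + x b3 *\<^sub>R b3"
    using b by (simp add: add.assoc)
  have x_nonneg: "0 \<le> x g" for g using G(3) by (simp add: x_def)
  define D' where "D' = det3 (r' q1) (r' q2) (r' q3)"
  define y1 y2 y3 where "y1 = det3 (r' p) (r' q2) (r' q3) / D'"
    and "y2 = det3 (r' q1) (r' p) (r' q3) / D'" and "y3 = det3 (r' q1) (r' q2) (r' p) / D'"
  have sD: "sgn D' = sgn (det3 b1 b2 b3)" using chirotope[of q1 q2 q3] q by (simp add: D'_def)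
  then have D': "D' \<noteq> 0" using nz by (metis sgn_zero_iff)
  have r'p: "r' p = y1 *\<^sub>R r' q1 + y2 *\<^sub>R r' q2 + y3 *\<^sub>R r' q3"
    using det3_cramer[of "r' q1" "r' q2" "r' q3" "r' p"] D' unfolding y1_def y2_def y3_def D'_def by blast
  have quot: "sgn (a / D') = sgn z" if "sgn a = sgn (z * det3 b1 b2 b3)" for a z
  proof -
    show ?thesis unfolding sgn_divide that sgn_mult sD using nz by simp
  qed
  have sgn: "sgn y1 = sgn (x b1)" "sgn y2 = sgn (x b2)" "sgn y3 = sgn (x b3)"
    unfolding y1_def y2_def y3_def
    using chirotope[of p q2 q3] chirotope[of q1 p q3] chirotope[of q1 q2 p]
    unfolding q det3_coeff(1)[OF rp] det3_coeff(2)[OF rp] det3_coeff(3)[OF rp]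
    by - (rule quot, simp)+
  have y: "0 \<le> a \<and> (a \<noteq> 0 \<longrightarrow> g \<in> G)" if "sgn a = sgn (x g)" for a g
  proof -
    have "0 \<le> a \<longleftrightarrow> 0 \<le> x g" "a = 0 \<longleftrightarrow> x g = 0"
      using that zero_le_sgn_iff[of a] zero_le_sgn_iff[of "x g"] sgn_zero_iff[of a] sgn_zero_iff[of "x g"]
      by simp_all
    then show ?thesis using x_nonneg[of g] by (auto simp: x_def)
  qed
  have yK: "0 \<le> y1 \<and> (y1 \<noteq> 0 \<longrightarrow> q1 \<in> K)" "0 \<le> y2 \<and> (y2 \<noteq> 0 \<longrightarrow> q2 \<in> K)"
    "0 \<le> y3 \<and> (y3 \<noteq> 0 \<longrightarrow> q3 \<in> K)"
    using y[OF sgn(1)] y[OF sgn(2)] y[OF sgn(3)] qK by simp_all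
  have distinct: "r' q1 \<noteq> r' q2" "r' q1 \<noteq> r' q3" "r' q2 \<noteq> r' q3"
    using D' by (auto simp: D'_def det3_def algebra_simps)
  define e where "e g = (if g = r' q1 then y1 else if g = r' q2 then y2 else y3)" for g
  \<comment> \<open>Dropping the zero coefficients leaves only indices in \<open>K\<close>.\<close>
  define F' where "F' = {g \<in> {r' q1, r' q2, r' q3}. e g \<noteq> 0}"
  have "r' p = (\<Sum>g\<in>{r' q1, r' q2, r' q3}. e g *\<^sub>R g)"
    using distinct distinct[symmetric] by (simp add: r'p e_def add.assoc)
  also have "\<dots> = (\<Sum>g\<in>F'. e g *\<^sub>R g)"
    unfolding F'_def by (intro sum.mono_neutral_right) auto
  finally have "r' p = (\<Sum>g\<in>F'. e g *\<^sub>R g)" .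
  moreover have "finite F'" "F' \<subseteq> insert 0 (r' ` K)" "\<forall>g\<in>F'. 0 \<le> e g"
    using yK unfolding F'_def e_def by (auto split: if_splits)
  ultimately show ?thesis unfolding nonneg_cone_def by blast
qed

section \<open>Coordinates for a root datum of rank three\<close>

context realized_root_datum
begin

lemma linear_pairing: "linear (\<lambda>v. pairing D v c)"
  using bilinear_pairing by (simp add: bilinear_def)

text \<open>Evaluating both reflections at \<alpha> gives 2 \<alpha> = p \<beta> with p \<le> 0,
  against positive independence.\<close>

lemma simple_reflection_inj: "inj_on (simple_reflection D) (simple_roots D)"
proof (rule inj_onI, rule ccontr)
  fix \<alpha> \<beta> assume \<alpha>: "\<alpha> \<in> simple_roots D" and \<beta>: "\<beta> \<in> simple_roots D"
    and eq: "simple_reflection D \<alpha> = simple_reflection D \<beta>" and ne: "\<alpha> \<noteq> \<beta>"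
  define p where "p = pairing D \<alpha> (coroot D \<beta>)"
  have p: "p \<le> 0" using pairing_nonpos[OF \<alpha> \<beta> ne] by (simp add: p_def)
  have "\<alpha> - 2 *\<^sub>R \<alpha> = \<alpha> - p *\<^sub>R \<beta>"
    using fun_cong[OF eq, of \<alpha>] pairing_self[OF \<alpha>] by (simp add: simple_reflection_def p_def)
  then have sum: "2 *\<^sub>R \<alpha> + (- p) *\<^sub>R \<beta> = 0" by simp
  have "positively_independent (simple_roots D)" by (rule positively_independent_roots)
  then have PI: "\<And>F c. finite F \<Longrightarrow> F \<noteq> {} \<Longrightarrow> F \<subseteq> simple_roots D \<Longrightarrow> \<forall>\<gamma>\<in>F. 0 < c \<gamma> \<Longrightarrow>
      (\<Sum>\<gamma>\<in>F. c \<gamma> *\<^sub>R \<gamma>) = 0 \<Longrightarrow> False"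
    unfolding positively_independent_def by blast
  show False
  proof (cases "p = 0")
    case True
    then show False using PI[of "{\<alpha>}" "\<lambda>_. 2"] sum \<alpha> by simp
  next
    case False
    then show False
      using PI[of "{\<alpha>, \<beta>}" "\<lambda>\<gamma>. if \<gamma> = \<alpha> then 2 else - p"] sum \<alpha> \<beta> ne p by simp
  qed
qed

end

text \<open>One labelling of the generators serves both root data, so that their Cartan matrices
  have a common index type and their roots common words.\<close>

locale labelled_root_datum = realized_root_datum_of W S D \<phi>
  for W :: "('g, 'm) monoid_scheme" (structure) and S :: "'g set"
    and D :: "('v::real_vector, 'c::real_vector) root_datum" and \<phi> :: "'g \<Rightarrow> 'v \<Rightarrow> 'v" +
  fixes \<rho> :: "3 \<Rightarrow> 'g"
  assumes bij_\<rho>: "bij_betw \<rho> UNIV S"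
begin

definition simple :: "3 \<Rightarrow> 'v" where
  "simple i = inv_into (simple_roots D) (simple_reflection D) (\<phi> (\<rho> i))"

definition cartan :: "3 \<Rightarrow> 3 \<Rightarrow> real" where
  "cartan i j = pairing D (simple i) (coroot D (simple j))"

definition emb :: "real^3 \<Rightarrow> 'v" where
  "emb x = (\<Sum>i\<in>UNIV. x $ i *\<^sub>R simple i)"

definition wp :: "3 list \<Rightarrow> 'g" where
  "wp w = word_prod W (map \<rho> w)"

lemma \<phi>_hom: "\<phi> \<in> hom W (reflection_group D)" and \<phi>_inj: "inj_on \<phi> (carrier W)"
  using iso_action by (auto simp: iso_def bij_betw_def)

lemma S_closed: "s \<in> S \<Longrightarrow> s \<in> carrier W"
  using generators_closed by blast

lemma \<rho>_in_S [simp]: "\<rho> i \<in> S"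
  using bij_\<rho> by (auto simp: bij_betw_def)

lemma \<rho>_closed [simp]: "\<rho> i \<in> carrier W"
  using S_closed by simp

lemma bij_simple: "bij_betw simple UNIV (simple_roots D)"
proof -
  have "bij_betw \<phi> S (simple_reflections D)"
    using \<phi>_inj generators_closed action_generators by (metis bij_betw_imageI inj_on_subset)
  moreover have "bij_betw (inv_into (simple_roots D) (simple_reflection D)) (simple_reflections D) (simple_roots D)"
    using simple_reflection_inj by (intro bij_betw_inv_into) (simp add: bij_betw_def simple_reflections_def)
  ultimately have "bij_betw (inv_into (simple_roots D) (simple_reflection D) \<circ> (\<phi> \<circ> \<rho>)) UNIV (simple_roots D)"
    using bij_\<rho> by (meson bij_betw_trans)
  moreover have "inv_into (simple_roots D) (simple_reflection D) \<circ> (\<phi> \<circ> \<rho>) = simple"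
    by (auto simp: simple_def)
  ultimately show ?thesis by simp
qed

lemma simple_in [simp]: "simple i \<in> simple_roots D"
  using bij_simple by (auto simp: bij_betw_def)

lemma simple_eq_iff [simp]: "simple i = simple j \<longleftrightarrow> i = j"
  using bij_simple by (auto simp: bij_betw_def inj_def)

lemma simple_roots_eq: "simple_roots D = range simple"
  using bij_simple by (auto simp: bij_betw_def)

lemma \<phi>_\<rho>: "\<phi> (\<rho> i) = simple_reflection D (simple i)"
proof -
  have "\<phi> (\<rho> i) \<in> simple_reflection D ` simple_roots D"
    using action_generators \<rho>_in_S unfolding simple_reflections_def by blast
  then show ?thesis unfolding simple_def by (simp add: f_inv_into_f)
qed

sublocale cartan: cartan_matrix cartan
proof
  fix i j :: 3
  show "cartan i i = 2" by (simp add: cartan_def pairing_self)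
  assume "i \<noteq> j"
  then have "simple i \<noteq> simple j" by simp
  then show "cartan i j \<le> 0" "cartan i j = 0 \<longleftrightarrow> cartan j i = 0"
    "cartan i j * cartan j i \<in> {4 * (cos (pi / real m))\<^sup>2 | m. 2 \<le> m} \<union> {4..}"
    unfolding cartan_def
    by (rule pairing_nonpos[OF simple_in simple_in] pairing_zero_iff[OF simple_in simple_in]
        pairing_prod[OF simple_in simple_in])+
qed

lemma linear_emb: "linear emb"
  by (rule linearI) (simp_all add: emb_def scaleR_left_distrib sum.distrib scaleR_sum_right)

lemma emb_axis: "emb (axis i 1) = simple i"
proof -
  have "emb (axis i 1) = (\<Sum>j\<in>UNIV. if j = i then simple j else 0)"
    unfolding emb_def by (rule sum.cong) (auto simp: axis_def)
  then show ?thesis by simp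
qed

lemma pairing_emb: "pairing D (emb x) (coroot D (simple j)) = (\<Sum>i\<in>UNIV. x $ i * cartan i j)"
  unfolding emb_def cartan_def
  by (simp add: linear_sum[OF linear_pairing] linear_scale[OF linear_pairing])

text \<open>In rank three a dependency has, up to sign, at most one negative coefficient.\<close>

lemma inj_emb: "inj emb"
proof -
  \<comment> \<open>In the pairing with coroot \<open>k\<close> all terms are nonpositive and the
    one at \<open>k\<close> is negative.\<close>
  have one_neg: False if x: "emb x = 0" "x $ k < 0" "\<And>j. j \<noteq> k \<Longrightarrow> 0 \<le> x $ j" for x k
  proof -
    have "0 = (\<Sum>i\<in>UNIV. x $ i * cartan i k)"
      using pairing_emb[of x k] x(1) linear_0[OF linear_pairing] by simp
    also have "\<dots> = x $ k * cartan k k + (\<Sum>i\<in>UNIV - {k}. x $ i * cartan i k)"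
      by (simp add: sum.remove[of UNIV k])
    also have "(\<Sum>i\<in>UNIV - {k}. x $ i * cartan i k) \<le> 0"
      using x(3) cartan.nonpos by (intro sum_nonpos) (auto intro: mult_nonneg_nonpos)
    finally show False using x(2) by (simp add: cartan.diag)
  qed
  have all_nonneg: "x = 0" if x: "emb x = 0" "nonneg x" for x
  proof (rule ccontr)
    assume "x \<noteq> 0"
    then obtain k where k: "x $ k \<noteq> 0" by (auto simp: vec_eq_iff)
    define I where "I = {i. x $ i \<noteq> 0}"
    define c where "c = (\<lambda>\<gamma>. x $ (inv_into UNIV simple \<gamma>))"
    have inj: "inj simple" by (simp add: inj_def)
    have c: "c (simple i) = x $ i" for i using inj by (simp add: c_def)
    have "(\<Sum>\<gamma>\<in>simple ` I. c \<gamma> *\<^sub>R \<gamma>) = (\<Sum>i\<in>I. x $ i *\<^sub>R simple i)"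
      by (subst sum.reindex) (auto simp: c inj_on_def)
    also have "\<dots> = emb x"
      unfolding emb_def I_def by (intro sum.mono_neutral_left) auto
    finally have sum: "(\<Sum>\<gamma>\<in>simple ` I. c \<gamma> *\<^sub>R \<gamma>) = 0" using x(1) by simp
    have "\<forall>\<gamma>\<in>simple ` I. 0 < c \<gamma>" using x(2) by (auto simp: c I_def nonneg_def order_le_less)
    moreover have "finite (simple ` I)" "simple ` I \<noteq> {}" "simple ` I \<subseteq> simple_roots D"
      using k by (auto simp: I_def)
    ultimately show False
      using positively_independent_roots sum unfolding positively_independent_def by blast
  qed
  have "x = 0" if x: "emb x = 0" for x
  proof -
    have x': "emb (- x) = 0" using x linear_neg[OF linear_emb, of x] by simp
    have "(\<exists>k. x $ k < 0 \<and> (\<forall>j. j \<noteq> k \<longrightarrow> 0 \<le> x $ j)) \<or>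
        (\<exists>k. (- x) $ k < 0 \<and> (\<forall>j. j \<noteq> k \<longrightarrow> 0 \<le> (- x) $ j)) \<or> nonneg x \<or> nonneg (- x)"
    proof -
      have ex3: "(\<exists>k::3. P k) \<longleftrightarrow> P 1 \<or> P 2 \<or> P 3" for P
        using exhaust_3 by metis
      show ?thesis
        unfolding nonneg_def
        by (cases "0 \<le> x $ 1"; cases "0 \<le> x $ 2"; cases "0 \<le> x $ 3") (auto simp: forall_3 ex3 order_le_less)
    qed
    then consider k where "x $ k < 0" "\<And>j. j \<noteq> k \<Longrightarrow> 0 \<le> x $ j"
      | k where "(- x) $ k < 0" "\<And>j. j \<noteq> k \<Longrightarrow> 0 \<le> (- x) $ j" | "nonneg x" | "nonneg (- x)"
      by blast
    then show ?thesis
    proof cases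
      case 1 then show ?thesis using one_neg[OF x] by blast
    next
      case 2 then show ?thesis using one_neg[OF x'] by blast
    next
      case 3 then show ?thesis using all_nonneg[OF x] by blast
    next
      case 4 then show ?thesis using all_nonneg[OF x'] by simp
    qed
  qed
  then show ?thesis using linear_injective_0[OF linear_emb] by blast
qed

lemma emb_eq_iff [simp]: "emb x = emb y \<longleftrightarrow> x = y"
  using inj_emb by (auto simp: inj_def)

lemma surj_emb: "surj emb"
proof -
  have "span (simple_roots D) \<subseteq> range emb"
  proof (rule span_minimal)
    show "simple_roots D \<subseteq> range emb" unfolding simple_roots_eq by (auto simp flip: emb_axis)
    show "subspace (range emb)" using linear_subspace_image[OF linear_emb subspace_UNIV] .
  qed
  then show ?thesis using span_roots by auto
qed

lemma emb_reflect: "simple_reflection D (simple i) (emb x) = emb (reflect cartan i x)"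
  by (simp add: simple_reflection_def reflect_def pairing_emb linear_diff[OF linear_emb]
      linear_scale[OF linear_emb] emb_axis)

section \<open>Words and group elements\<close>

lemma wp_simps [simp]: "wp [] = \<one>" "wp (i # w) = \<rho> i \<otimes> wp w"
  by (simp_all add: wp_def word_prod_def)

lemma wp_closed [simp]: "wp w \<in> carrier W"
  by (induction w) auto

lemma wp_append: "wp (u @ w) = wp u \<otimes> wp w"
  by (induction u) (auto simp: m_assoc)

lemma \<rho>_square: "\<rho> i \<otimes> \<rho> i = \<one>"
  using pow_ord_eq_1[of "\<rho> i"] generator_order[of "\<rho> i"] by (simp add: numeral_2_eq_2)

lemma wp_rev: "wp (rev w) = inv (wp w)"
proof (induction w)
  case (Cons i w)
  have "inv (\<rho> i) = \<rho> i" by (rule inv_equality[OF \<rho>_square]) auto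
  then have "inv (wp (i # w)) = inv (wp w) \<otimes> \<rho> i" by (simp add: inv_mult_group)
  also have "\<dots> = wp (rev (i # w))" by (simp add: wp_append Cons)
  finally show ?case ..
qed simp

lemma carrier_eq_wp: "carrier W = range wp"
proof -
  have "x \<in> range wp" if "x \<in> generate W S" for x
    using that
  proof (induction rule: generate.induct)
    case one
    have "\<one> = wp []" by simp
    then show ?case by blast
  next
    case (incl s)
    then obtain i where "s = \<rho> i" using bij_\<rho> by (auto simp: bij_betw_def)
    then have "s = wp [i]" by simp
    then show ?case by blast
  next
    case (inv s)
    then obtain i where "s = \<rho> i" using bij_\<rho> by (auto simp: bij_betw_def)
    then have "inv s = wp (rev [i])" unfolding wp_rev by simp
    then show ?case by blast
  next
    case (eng x y)
    then obtain u w where "x = wp u" "y = wp w" by blast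
    then have "x \<otimes> y = wp (u @ w)" by (simp add: wp_append)
    then show ?case by blast
  qed
  then show ?thesis using generates by auto
qed

lemma \<phi>_mult:
  assumes "x \<in> carrier W" "y \<in> carrier W"
  shows "\<phi> (x \<otimes> y) v = \<phi> x (\<phi> y v)"
proof -
  have "carrier (reflection_group D) \<subseteq> Bij UNIV"
    using group.carrier_subgroup_generated_subset[OF group_BijGroup, of "UNIV :: 'v set"]
    by (auto simp: reflection_group_def BijGroup_def)
  then have "\<phi> x \<in> Bij UNIV" "\<phi> y \<in> Bij UNIV"
    using assms \<phi>_hom by (auto simp: hom_def)
  moreover have "\<phi> (x \<otimes> y) = \<phi> x \<otimes>\<^bsub>reflection_group D\<^esub> \<phi> y"
    using assms \<phi>_hom by (auto simp: hom_def)
  ultimately show ?thesis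
    by (simp add: reflection_group_def BijGroup_def compose_def)
qed

lemma \<phi>_wp: "\<phi> (wp w) (emb x) = emb (act cartan w x)"
proof (induction w)
  case Nil
  \<comment> \<open>An idempotent injective map is the identity.\<close>
  have "\<phi> \<one> (\<phi> \<one> (emb x)) = \<phi> \<one> (emb x)" using \<phi>_mult[of \<one> \<one> "emb x"] by simp
  moreover have "\<phi> \<one> \<in> carrier (reflection_group D)" using \<phi>_hom by (auto simp: hom_def)
  then have "\<phi> \<one> \<in> Bij UNIV"
    using group.carrier_subgroup_generated_subset[OF group_BijGroup, of "UNIV :: 'v set"]
    by (auto simp: reflection_group_def BijGroup_def)
  then have "inj (\<phi> \<one>)" by (auto simp: Bij_def bij_betw_def)
  ultimately show ?case by (simp add: inj_eq)
next
  case (Cons i w)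
  then show ?case by (simp add: \<phi>_mult \<phi>_\<rho> emb_reflect)
qed

text \<open>The bridge between the two data: equality of words in \<open>W\<close> does not mention
  the datum, so relations between words hold for both Cartan matrices or for neither.\<close>

lemma wp_eq_iff: "wp u = wp w \<longleftrightarrow> act cartan u = act cartan w"
proof
  assume "wp u = wp w"
  then show "act cartan u = act cartan w"
    using \<phi>_wp by (metis emb_eq_iff ext)
next
  assume eq: "act cartan u = act cartan w"
  have "\<phi> (wp u) = \<phi> (wp w)"
  proof
    fix v
    obtain x where "v = emb x" using surj_emb by blast
    then show "\<phi> (wp u) v = \<phi> (wp w) v" by (simp add: \<phi>_wp eq)
  qed
  then show "wp u = wp w" using \<phi>_inj by (simp add: inj_on_eq_iff)
qed

section \<open>The closure operator in terms of words\<close>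

abbreviation rt :: "3 list \<times> 3 \<Rightarrow> real^3" where
  "rt q \<equiv> root cartan (fst q) (snd q)"

text \<open>\<open>signed_reflection\<close> read on the word that names a root; the datum enters
  only through the sign of the root.\<close>

definition label :: "3 list \<times> 3 \<Rightarrow> 'g \<times> int" where
  "label q = (wp (fst q @ [snd q] @ rev (fst q)), if nonneg (rt q) then 1 else - 1)"

lemma root_system_eq: "root_system W D \<phi> = range (\<lambda>q. emb (rt q))"
proof -
  have "root_system W D \<phi> = {\<phi> (wp w) (simple i) | w i. True}"
    unfolding root_system_def carrier_eq_wp simple_roots_eq by auto
  also have "\<dots> = {emb (root cartan w i) | w i. True}"
    by (simp add: \<phi>_wp flip: emb_axis)
  also have "\<dots> = range (\<lambda>q. emb (rt q))"
    by (simp add: full_SetCompr_eq[symmetric])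
  finally show ?thesis .
qed

lemma nonneg_cone_emb: "nonneg_cone (emb ` X) = emb ` nonneg_cone X"
  by (rule nonneg_cone_image[OF linear_emb inj_emb])

lemma emb_in_nonneg_cone: "emb x \<in> nonneg_cone (emb ` X) \<longleftrightarrow> x \<in> nonneg_cone X"
  unfolding nonneg_cone_emb by (auto dest: injD[OF inj_emb])

lemma positive_iff: "emb (rt q) \<in> positive_roots W D \<phi> \<longleftrightarrow> nonneg (rt q)"
proof -
  have "simple_roots D = emb ` range (\<lambda>i. axis i 1)"
    unfolding simple_roots_eq by (simp add: emb_axis image_image)
  then show ?thesis
    using root_system_eq by (simp add: positive_roots_def emb_in_nonneg_cone nonneg_cone_axis)
qed

text \<open>The description is unique because, by \<open>same_root_same_reflection\<close>, the
  reflection depends only on the root and not on the word naming it.\<close>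

lemma root_reflection_eq:
  "root_reflection W S D \<phi> (emb (root cartan w i)) = wp (w @ [i] @ rev w)"
  unfolding root_reflection_def
proof (rule the_equality)
  have "emb (root cartan w i) = \<phi> (wp w) (simple i)" by (simp add: \<phi>_wp flip: emb_axis)
  moreover have "wp (w @ [i] @ rev w) = wp w \<otimes> \<rho> i \<otimes> inv wp w"
    by (simp add: wp_append wp_rev m_assoc)
  ultimately show "\<exists>x\<in>carrier W. \<exists>\<beta>\<in>simple_roots D. \<exists>s\<in>S. emb (root cartan w i) = \<phi> x \<beta> \<and>
      \<phi> s = simple_reflection D \<beta> \<and> wp (w @ [i] @ rev w) = x \<otimes> s \<otimes> inv x"
    using wp_closed simple_in \<rho>_in_S \<phi>_\<rho> by blast
next
  fix t assume "\<exists>x\<in>carrier W. \<exists>\<beta>\<in>simple_roots D. \<exists>s\<in>S. emb (root cartan w i) = \<phi> x \<beta> \<and>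
      \<phi> s = simple_reflection D \<beta> \<and> t = x \<otimes> s \<otimes> inv x"
  then obtain u j s where s: "s \<in> S" "\<phi> s = simple_reflection D (simple j)"
    and root: "emb (root cartan w i) = \<phi> (wp u) (simple j)" and t: "t = wp u \<otimes> s \<otimes> inv (wp u)"
    unfolding carrier_eq_wp simple_roots_eq by blast
  have "s = \<rho> j" using s \<phi>_\<rho>[of j] inj_onD[OF \<phi>_inj] S_closed by simp
  then have t': "t = wp (u @ [j] @ rev u)" by (simp add: t wp_append wp_rev m_assoc)
  have "root cartan w i = root cartan u j" using root by (simp add: \<phi>_wp flip: emb_axis)
  then show "t = wp (w @ [i] @ rev w)"
    unfolding t' wp_eq_iff by (metis cartan.same_root_same_reflection)
qed

lemma signed_reflection_eq: "signed_reflection W S D \<phi> (emb (rt q)) = label q"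
proof -
  obtain w i where q: "q = (w, i)" by (cases q)
  have "- emb (root cartan w i) = emb (root cartan (w @ [i]) i)"
    unfolding cartan.root_snoc_neg by (simp add: linear_neg[OF linear_emb])
  then have "root_reflection W S D \<phi> (- emb (root cartan w i)) = wp ((w @ [i]) @ [i] @ rev (w @ [i]))"
    by (simp only: root_reflection_eq)
  also have "\<dots> = wp (w @ [i] @ rev w)"
    unfolding wp_eq_iff by (simp add: fun_eq_iff)
  finally show ?thesis
    using positive_iff[of q] root_reflection_eq[of w i]
    by (simp add: signed_reflection_def label_def q)
qed

text \<open>Moves the closure to the index type of words, common to both data; what remains to be
  compared is \<open>label\<close> and cone membership.\<close>

lemma root_closure_eq:
  "root_closure W S D \<phi> X = label ` {q. rt q \<in> nonneg_cone (rt ` {q. label q \<in> X})}"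
proof -
  have "signed_reflection W S D \<phi> -` X \<inter> root_system W D \<phi> = emb ` rt ` {q. label q \<in> X}"
  proof (intro subset_antisym subsetI)
    fix v assume "v \<in> signed_reflection W S D \<phi> -` X \<inter> root_system W D \<phi>"
    then obtain q where "v = emb (rt q)" "signed_reflection W S D \<phi> v \<in> X"
      unfolding root_system_eq by blast
    then show "v \<in> emb ` rt ` {q. label q \<in> X}" using signed_reflection_eq[of q] by auto
  next
    fix v assume "v \<in> emb ` rt ` {q. label q \<in> X}"
    then obtain q where "v = emb (rt q)" "label q \<in> X" by blast
    then show "v \<in> signed_reflection W S D \<phi> -` X \<inter> root_system W D \<phi>"
      using signed_reflection_eq[of q] unfolding root_system_eq by blast
  qed
  then have "root_closure W S D \<phi> X = signed_reflection W S D \<phi> `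
      (nonneg_cone (emb ` rt ` {q. label q \<in> X}) \<inter> range (\<lambda>q. emb (rt q)))"
    unfolding root_closure_def root_cone_def root_system_eq by simp
  also have "nonneg_cone (emb ` rt ` {q. label q \<in> X}) \<inter> range (\<lambda>q. emb (rt q))
      = (\<lambda>q. emb (rt q)) ` {q. emb (rt q) \<in> nonneg_cone (emb ` rt ` {q. label q \<in> X})}"
    by blast
  also have "signed_reflection W S D \<phi> ` \<dots> = label ` {q. emb (rt q) \<in> nonneg_cone (emb ` rt ` {q. label q \<in> X})}"
    by (simp add: image_image signed_reflection_eq)
  finally show ?thesis unfolding emb_in_nonneg_cone .
qed

end

theorem theorem5p2:
  fixes W :: "('g, 'm) monoid_scheme" and S :: "'g set"
    and D :: "('v::real_vector, 'c::real_vector) root_datum" and \<phi> :: "'g \<Rightarrow> 'v \<Rightarrow> 'v"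
    and D' :: "('w::real_vector, 'd::real_vector) root_datum" and \<phi>' :: "'g \<Rightarrow> 'w \<Rightarrow> 'w"
  assumes "coxeter_system W S"
    and "card S = 3"
    and "realized_root_datum_of W S D \<phi>"
    and "realized_root_datum_of W S D' \<phi>'"
  shows "\<forall>A \<subseteq> reflections W S \<times> {1, -1}. root_closure W S D \<phi> A = root_closure W S D' \<phi>' A"
proof -
  have "finite S" using assms(2) by (simp add: card_ge_0_finite)
  then obtain \<rho> :: "3 \<Rightarrow> 'g" where \<rho>: "bij_betw \<rho> UNIV S"
    using finite_same_card_bij[of "UNIV :: 3 set" S] assms(2) by auto
  interpret X: labelled_root_datum W S D \<phi> \<rho>
    using assms(3) \<rho> by (simp add: labelled_root_datum_def labelled_root_datum_axioms_def)
  interpret Y: labelled_root_datum W S D' \<phi>' \<rho>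
    using assms(4) \<rho> by (simp add: labelled_root_datum_def labelled_root_datum_axioms_def)
  have act_eq: "act X.cartan u = act X.cartan w \<longleftrightarrow> act Y.cartan u = act Y.cartan w" for u w
    using X.wp_eq_iff[of u w] Y.wp_eq_iff[of u w] by blast
  have type: "same_type X.cartan Y.cartan"
  proof (rule same_typeI[OF X.cartan.cartan_matrix_axioms Y.cartan.cartan_matrix_axioms])
    show "X.cartan.braid n i j \<longleftrightarrow> Y.cartan.braid n i j" for n i j
      unfolding X.cartan.braid_def Y.cartan.braid_def by (rule act_eq)
  qed
  note hyps = X.cartan.cartan_matrix_axioms Y.cartan.cartan_matrix_axioms type
  interpret cartan_pair X.cartan Y.cartan
    by (rule same_type_cartan_pair[OF hyps])
  \<comment> \<open>\<open>wp\<close> involves only \<open>W\<close> and \<rho>, and the signs agree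
    by \<open>same_sign\<close>.\<close>
  have label: "X.label = Y.label"
    unfolding X.label_def[abs_def] Y.label_def[abs_def] same_sign ..
  have span: "span (range (\<lambda>q. root C (fst q) (snd q))) = UNIV" for C :: "3 \<Rightarrow> 3 \<Rightarrow> real"
  proof -
    have "Basis \<subseteq> range (\<lambda>q. root C (fst q) (snd q))"
    proof
      fix v :: "real^3" assume "v \<in> Basis"
      then obtain i where "v = axis i 1" by (auto simp: Basis_vec_def)
      then show "v \<in> range (\<lambda>q. root C (fst q) (snd q))"
        by (intro range_eqI[of _ _ "([], i)"]) simp
    qed
    then show ?thesis using span_mono[of Basis] by auto
  qed
  note chirotope = same_type_chirotope[OF hyps]
  have "X.rt q \<in> nonneg_cone (X.rt ` K) \<longleftrightarrow> Y.rt q \<in> nonneg_cone (Y.rt ` K)" for q K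
    using cone_transfer[OF chirotope span] cone_transfer[OF chirotope[symmetric] span] by blast
  then show ?thesis by (simp add: X.root_closure_eq Y.root_closure_eq label)
qed

end
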